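(* Let $f: X\to Y$ be a homotopy equivalence of topological spaces, let $g: Y\to X$ be a homotopy inverse of $f$, let $R$ be a local coefficient system on $X$, and let $R'=g^\ast R$ be the induced local coefficient system on $Y$. Then for any homology class $z\in H_q(X;R)$ one has $$\mathrm{cwgt}(z)=\mathrm{cwgt}(f_\ast(z)),$$ where $f_\ast(z)\in H_q(Y;R')$.
   Context: For a topological space $X$ and a subset $A\subset X$, $\mathrm{cat}_X A\le k$ means that $A$ can be covered by $k$ open subsets $U_1,\dots,U_k\subset X$ such that each inclusion $U_i\to X$ is null-homotopic (homotopic to a constant map; the empty set is allowed). Category weight of a homology class: for $z\in H_q(X;R)$ (singular homology, $R$ a local coefficient system on $X$) and an integer $k\ge 0$, one says $\mathrm{cwgt}(z)\ge k$ if for every closed subset $A\subset X$ with $\mathrm{cat}_XA\le k$ there is a singular cycle in $X-A$ representing $z$, i.e. $z\in \mathrm{Im}[H_q(X-A;R)\to H_q(X;R)]$. One has $\mathrm{cwgt}(z)=k$ iff $\mathrm{cwgt}(z)\ge k$ and not $\mathrm{cwgt}(z)\ge k+1$; $\mathrm{cwgt}(z)=+\infty$ if $\mathrm{cwgt}(z)\ge k$ for all $k$ (in particular $\mathrm{cwgt}(0)=+\infty$). Since $g\circ f\simeq 1_X$, the system $f^\ast R'=(g\circ f)^\ast R$ is identified with $R$ by means of a homotopy $g\circ f\simeq 1_X$; this is how $f_\ast: H_q(X;R)\to H_q(Y;R')$ is defined. *)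

theory Defs
  imports
    "HOL-Analysis.Analysis"
    "HOL-Homology.Homology"
    "HOL-Library.Extended_Nat"
begin

section \<open>Local coefficient systems\<close>

text \<open>
  A local coefficient system on \<open>X\<close> assigns an abelian group to every point of \<open>X\<close> and an
  isomorphism between the groups at the end points to every path, compatibly with constant paths,
  concatenation and homotopy relative to the end points; that is, it is a functor from the
  fundamental groupoid of \<open>X\<close> to abelian groups. As in \<open>HOL-Homology\<close>, abelian groups are
  multiplicative \<open>comm_group\<close>s. The carriers at different points may differ; the common type
  \<open>'r\<close> only hosts them.
\<close>

record ('a, 'r) coeff_system =
  fibre :: "'a \<Rightarrow> 'r monoid"
  transport :: "(real \<Rightarrow> 'a) \<Rightarrow> 'r \<Rightarrow> 'r"

text \<open>\<open>(+++)\<close> is not available here, as it needs points of a type of class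
  \<open>topological_space\<close>.\<close>

definition path_concat :: "(real \<Rightarrow> 'a) \<Rightarrow> (real \<Rightarrow> 'a) \<Rightarrow> real \<Rightarrow> 'a" where
  "path_concat p p' = (\<lambda>t. if t \<le> 1/2 then p (2 * t) else p' (2 * t - 1))"

definition path_homotopic :: "'a topology \<Rightarrow> (real \<Rightarrow> 'a) \<Rightarrow> (real \<Rightarrow> 'a) \<Rightarrow> bool" where
  "path_homotopic X p p' \<longleftrightarrow>
     homotopic_with (\<lambda>r. r 0 = p 0 \<and> r 1 = p 1) (top_of_set {0..1}) X p p'"

definition local_system :: "'a topology \<Rightarrow> ('a, 'r) coeff_system \<Rightarrow> bool" where
  "local_system X R \<longleftrightarrow>
     (\<forall>x \<in> topspace X. comm_group (fibre R x)) \<and>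
     (\<forall>p. pathin X p \<longrightarrow> transport R p \<in> iso (fibre R (p 0)) (fibre R (p 1))) \<and>
     (\<forall>x \<in> topspace X. \<forall>r \<in> carrier (fibre R x). transport R (\<lambda>t. x) r = r) \<and>
     (\<forall>p p'. pathin X p \<longrightarrow> pathin X p' \<longrightarrow> p 1 = p' 0 \<longrightarrow>
        (\<forall>r \<in> carrier (fibre R (p 0)).
           transport R (path_concat p p') r = transport R p' (transport R p r))) \<and>
     (\<forall>p p'. path_homotopic X p p' \<longrightarrow>
        (\<forall>r \<in> carrier (fibre R (p 0)). transport R p r = transport R p' r))"

definition pullback_system :: "('b \<Rightarrow> 'a) \<Rightarrow> ('a, 'r) coeff_system \<Rightarrow> ('b, 'r) coeff_system" where
  "pullback_system g R = \<lparr>fibre = (\<lambda>y. fibre R (g y)), transport = (\<lambda>p. transport R (g \<circ> p))\<rparr>"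

lemma local_system_pullback:
  assumes R: "local_system X R" and g: "continuous_map Y X g"
  shows "local_system Y (pullback_system g R)"
proof -
  have conc: "g \<circ> path_concat p p' = path_concat (g \<circ> p) (g \<circ> p')" for p p'
    by (auto simp: path_concat_def fun_eq_iff)
  have hom: "path_homotopic X (g \<circ> p) (g \<circ> p')" if "path_homotopic Y p p'" for p p'
    unfolding path_homotopic_def
    by (rule homotopic_with_compose_continuous_map_left
          [OF that[unfolded path_homotopic_def] g]) auto
  have pt: "g y \<in> topspace X" if "y \<in> topspace Y" for y
    using g that by (auto simp: continuous_map_def)
  have path: "pathin X (g \<circ> p)" if "pathin Y p" for p
    using pathin_compose[OF that g] .
  have const: "g \<circ> (\<lambda>t. y) = (\<lambda>t :: real. g y)" for y
    by auto
  have R1: "\<And>x. x \<in> topspace X \<Longrightarrow> comm_group (fibre R x)"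
    and R2: "\<And>p. pathin X p \<Longrightarrow> transport R p \<in> iso (fibre R (p 0)) (fibre R (p 1))"
    and R3: "\<And>x r. x \<in> topspace X \<Longrightarrow> r \<in> carrier (fibre R x) \<Longrightarrow> transport R (\<lambda>t. x) r = r"
    and R4: "\<And>p p' r. pathin X p \<Longrightarrow> pathin X p' \<Longrightarrow> p 1 = p' 0 \<Longrightarrow> r \<in> carrier (fibre R (p 0))
              \<Longrightarrow> transport R (path_concat p p') r = transport R p' (transport R p r)"
    and R5: "\<And>p p' r. path_homotopic X p p' \<Longrightarrow> r \<in> carrier (fibre R (p 0))
              \<Longrightarrow> transport R p r = transport R p' r"
    using R unfolding local_system_def by blast+
  show ?thesis
    unfolding local_system_def pullback_system_def coeff_system.simps conc const
  proof (intro conjI allI impI ballI)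
    fix y assume "y \<in> topspace Y"
    then show "comm_group (fibre R (g y))" by (intro R1 pt)
  next
    fix p assume "pathin Y p"
    then show "transport R (g \<circ> p) \<in> iso (fibre R (g (p 0))) (fibre R (g (p 1)))"
      using R2[OF path] by simp
  next
    fix y r assume "y \<in> topspace Y" "r \<in> carrier (fibre R (g y))"
    then show "transport R (\<lambda>t. g y) r = r" by (intro R3 pt)
  next
    fix p p' r
    assume "pathin Y p" "pathin Y p'" "p 1 = p' 0" "r \<in> carrier (fibre R (g (p 0)))"
    then show "transport R (path_concat (g \<circ> p) (g \<circ> p')) r
                 = transport R (g \<circ> p') (transport R (g \<circ> p) r)"
      by (intro R4 path) auto
  next
    fix p p' r
    assume "path_homotopic Y p p'" "r \<in> carrier (fibre R (g (p 0)))"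
    then show "transport R (g \<circ> p) r = transport R (g \<circ> p') r"
      by (intro R5 hom) auto
  qed
qed

lemma local_system_subtopology:
  assumes "local_system X R"
  shows "local_system (subtopology X S) R"
proof -
  have "pullback_system id R = R"
    by (cases R) (simp add: pullback_system_def)
  then show ?thesis
    using local_system_pullback[OF assms, of "subtopology X S" id]
    by (simp add: continuous_map_from_subtopology)
qed


section \<open>Singular homology with local coefficients\<close>

definition simplex_vertex0 :: "nat \<Rightarrow> real" where
  "simplex_vertex0 = (\<lambda>i. if i = 0 then 1 else 0)"

definition simplex_edge01 :: "real \<Rightarrow> nat \<Rightarrow> real" where
  "simplex_edge01 t = (\<lambda>i. if i = 0 then 1 - t else if i = 1 then t else 0)"

text \<open>
  A chain is a finite formal combination of singular simplices \<open>\<sigma>\<close>, where the coefficient of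
  \<open>\<sigma>\<close> lies in the fibre over the image under \<open>\<sigma>\<close> of the leading vertex.
\<close>

definition local_chain_group ::
    "nat \<Rightarrow> 'a topology \<Rightarrow> ('a, 'r) coeff_system \<Rightarrow> (((nat \<Rightarrow> real) \<Rightarrow> 'a) \<Rightarrow> 'r) monoid" where
  "local_chain_group q X R =
     sum_group (singular_simplex_set q X) (\<lambda>\<sigma>. fibre R (\<sigma> simplex_vertex0))"

definition local_support ::
    "nat \<Rightarrow> 'a topology \<Rightarrow> ('a, 'r) coeff_system \<Rightarrow> (((nat \<Rightarrow> real) \<Rightarrow> 'a) \<Rightarrow> 'r)
       \<Rightarrow> ((nat \<Rightarrow> real) \<Rightarrow> 'a) set" where
  "local_support q X R c =
     {\<sigma> \<in> singular_simplex_set q X. c \<sigma> \<noteq> \<one>\<^bsub>fibre R (\<sigma> simplex_vertex0)\<^esub>}"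

text \<open>The chain with the single coefficient \<open>r\<close> at \<open>\<sigma>\<close>.\<close>

definition elementary_chain ::
    "nat \<Rightarrow> 'a topology \<Rightarrow> ('a, 'r) coeff_system \<Rightarrow> 'r \<Rightarrow> ((nat \<Rightarrow> real) \<Rightarrow> 'a)
       \<Rightarrow> ((nat \<Rightarrow> real) \<Rightarrow> 'a) \<Rightarrow> 'r" where
  "elementary_chain q X R r \<sigma> =
     (\<lambda>\<tau> \<in> singular_simplex_set q X. if \<tau> = \<sigma> then r else \<one>\<^bsub>fibre R (\<tau> simplex_vertex0)\<^esub>)"

text \<open>
  The leading vertex of the zeroth face of \<open>\<sigma>\<close> is vertex 1 of \<open>\<sigma>\<close>, so on this face the
  coefficient is transported along the edge from vertex 0 to vertex 1. All other faces have the
  same leading vertex as \<open>\<sigma>\<close>. In degree 0 the boundary is trivial, as for \<open>chain_boundary\<close>.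
\<close>

definition local_boundary ::
    "nat \<Rightarrow> 'a topology \<Rightarrow> ('a, 'r) coeff_system \<Rightarrow> (((nat \<Rightarrow> real) \<Rightarrow> 'a) \<Rightarrow> 'r)
       \<Rightarrow> ((nat \<Rightarrow> real) \<Rightarrow> 'a) \<Rightarrow> 'r" where
  "local_boundary q X R c =
     (if q = 0 then \<one>\<^bsub>local_chain_group (q - 1) X R\<^esub>
      else finprod (local_chain_group (q - 1) X R)
        (\<lambda>\<sigma>. finprod (local_chain_group (q - 1) X R)
          (\<lambda>k. elementary_chain (q - 1) X R
                 (if k = 0 then transport R (\<lambda>t. \<sigma> (simplex_edge01 t)) (c \<sigma>) else c \<sigma>)
                 (singular_face q k \<sigma>)
               [^]\<^bsub>local_chain_group (q - 1) X R\<^esub> ((- 1) ^ k :: int))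
          {..q})
        (local_support q X R c))"

definition local_cycles ::
    "nat \<Rightarrow> 'a topology \<Rightarrow> ('a, 'r) coeff_system \<Rightarrow> (((nat \<Rightarrow> real) \<Rightarrow> 'a) \<Rightarrow> 'r) set" where
  "local_cycles q X R =
     {c \<in> carrier (local_chain_group q X R).
        local_boundary q X R c = \<one>\<^bsub>local_chain_group (q - 1) X R\<^esub>}"

definition local_boundaries ::
    "nat \<Rightarrow> 'a topology \<Rightarrow> ('a, 'r) coeff_system \<Rightarrow> (((nat \<Rightarrow> real) \<Rightarrow> 'a) \<Rightarrow> 'r) set" where
  "local_boundaries q X R =
     local_boundary (Suc q) X R ` carrier (local_chain_group (Suc q) X R)"

definition local_homology_group ::
    "nat \<Rightarrow> 'a topology \<Rightarrow> ('a, 'r) coeff_system \<Rightarrow> (((nat \<Rightarrow> real) \<Rightarrow> 'a) \<Rightarrow> 'r) set monoid" where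
  "local_homology_group q X R =
     subgroup_generated (local_chain_group q X R) (local_cycles q X R) Mod local_boundaries q X R"

text \<open>
  A continuous map \<open>f\<close> from \<open>X\<close> to \<open>Y\<close> together with homomorphisms \<open>\<phi> x\<close> from \<open>fibre R x\<close> to
  \<open>fibre S (f x)\<close> that commute with transport (a morphism from \<open>R\<close> to the pullback of \<open>S\<close> along
  \<open>f\<close>) induces maps on chains and on homology. On homology, the set product with the subgroup of
  boundaries turns the image of a coset, which is only contained in a coset, into a whole coset.
\<close>

definition local_chain_map ::
    "nat \<Rightarrow> 'a topology \<Rightarrow> ('a, 'r) coeff_system \<Rightarrow> 'b topology \<Rightarrow> ('b, 's) coeff_system
       \<Rightarrow> ('a \<Rightarrow> 'b) \<Rightarrow> ('a \<Rightarrow> 'r \<Rightarrow> 's)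
       \<Rightarrow> (((nat \<Rightarrow> real) \<Rightarrow> 'a) \<Rightarrow> 'r) \<Rightarrow> ((nat \<Rightarrow> real) \<Rightarrow> 'b) \<Rightarrow> 's" where
  "local_chain_map q X R Y S f \<phi> c =
     finprod (local_chain_group q Y S)
       (\<lambda>\<sigma>. elementary_chain q Y S (\<phi> (\<sigma> simplex_vertex0) (c \<sigma>)) (simplex_map q f \<sigma>))
       (local_support q X R c)"

definition local_hom_induced ::
    "nat \<Rightarrow> 'a topology \<Rightarrow> ('a, 'r) coeff_system \<Rightarrow> 'b topology \<Rightarrow> ('b, 's) coeff_system
       \<Rightarrow> ('a \<Rightarrow> 'b) \<Rightarrow> ('a \<Rightarrow> 'r \<Rightarrow> 's)
       \<Rightarrow> (((nat \<Rightarrow> real) \<Rightarrow> 'a) \<Rightarrow> 'r) set \<Rightarrow> (((nat \<Rightarrow> real) \<Rightarrow> 'b) \<Rightarrow> 's) set" where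
  "local_hom_induced q X R Y S f \<phi> z =
     local_boundaries q Y S <#>\<^bsub>local_chain_group q Y S\<^esub> (local_chain_map q X R Y S f \<phi> ` z)"


section \<open>Category weight of homology classes\<close>

definition cat_le :: "'a topology \<Rightarrow> 'a set \<Rightarrow> nat \<Rightarrow> bool" where
  "cat_le X A k \<longleftrightarrow>
     (\<exists>U :: nat \<Rightarrow> 'a set.
        A \<subseteq> (\<Union>i<k. U i) \<and>
        (\<forall>i<k. openin X (U i) \<and>
               (\<exists>a. homotopic_with (\<lambda>h. True) (subtopology X (U i)) X id (\<lambda>x. a))))"

definition cwgt_ge ::
    "nat \<Rightarrow> 'a topology \<Rightarrow> ('a, 'r) coeff_system \<Rightarrow> (((nat \<Rightarrow> real) \<Rightarrow> 'a) \<Rightarrow> 'r) set \<Rightarrow> nat \<Rightarrow> bool"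
  where
  "cwgt_ge q X R z k \<longleftrightarrow>
     (\<forall>A. closedin X A \<longrightarrow> cat_le X A k \<longrightarrow>
        z \<in> local_hom_induced q (subtopology X (topspace X - A)) R X R id (\<lambda>x. id)
              ` carrier (local_homology_group q (subtopology X (topspace X - A)) R))"

definition cwgt ::
    "nat \<Rightarrow> 'a topology \<Rightarrow> ('a, 'r) coeff_system \<Rightarrow> (((nat \<Rightarrow> real) \<Rightarrow> 'a) \<Rightarrow> 'r) set \<Rightarrow> enat" where
  "cwgt q X R z =
     (if \<forall>k. cwgt_ge q X R z k then \<infinity>
      else enat (THE k. cwgt_ge q X R z k \<and> \<not> cwgt_ge q X R z (Suc k)))"

text \<open>The description in \<open>cwgt\<close> singles out a unique number as soon as \<open>cwgt_ge q X R z 0\<close> holds.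
  This is so for every homology class \<open>z\<close>, because \<open>cat_le X A 0\<close> only holds for empty \<open>A\<close>.\<close>

lemma cat_le_mono:
  assumes "cat_le X A k" "k \<le> l"
  shows "cat_le X A l"
proof -
  obtain U where U: "A \<subseteq> (\<Union>i<k. U i)"
      "\<And>i. i < k \<Longrightarrow> openin X (U i) \<and>
         (\<exists>a. homotopic_with (\<lambda>h. True) (subtopology X (U i)) X id (\<lambda>x. a))"
    using assms(1) unfolding cat_le_def by blast
  have "homotopic_with (\<lambda>h. True) (subtopology X {}) X id (\<lambda>x. a)" for a
    by (simp add: homotopic_on_emptyI)
  with U show ?thesis
    unfolding cat_le_def using assms(2)
    by (intro exI[of _ "\<lambda>i. if i < k then U i else {}"]) fastforce
qed

lemma cwgt_ge_antimono: "cwgt_ge q X R z l \<Longrightarrow> k \<le> l \<Longrightarrow> cwgt_ge q X R z k"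
  unfolding cwgt_ge_def using cat_le_mono by blast

lemma cwgt_eq_enat_iff:
  assumes "cwgt_ge q X R z 0"
  shows "cwgt q X R z = enat k \<longleftrightarrow> cwgt_ge q X R z k \<and> \<not> cwgt_ge q X R z (Suc k)"
proof -
  have uniq: "m = n"
    if "cwgt_ge q X R z m \<and> \<not> cwgt_ge q X R z (Suc m)"
       "cwgt_ge q X R z n \<and> \<not> cwgt_ge q X R z (Suc n)" for m n
    using that cwgt_ge_antimono by (metis not_less_eq_eq order_antisym_conv nat_le_linear)
  have ex: "\<exists>m. cwgt_ge q X R z m \<and> \<not> cwgt_ge q X R z (Suc m)"
    if "\<not> (\<forall>m. cwgt_ge q X R z m)"
    using that assms by (metis nat_induct)
  show ?thesis
  proof (cases "\<forall>m. cwgt_ge q X R z m")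
    case True
    then show ?thesis by (simp add: cwgt_def)
  next
    case False
    from ex[OF False] obtain m
      where m: "cwgt_ge q X R z m \<and> \<not> cwgt_ge q X R z (Suc m)" ..
    then have "(THE k. cwgt_ge q X R z k \<and> \<not> cwgt_ge q X R z (Suc k)) = m"
      using uniq by (intro the_equality) blast+
    with False m uniq show ?thesis by (auto simp: cwgt_def)
  qed
qed

end

theory Submission
  imports Defs
begin

text \<open>
  Preimages under \<open>f\<close> and \<open>g\<close> of closed sets of category at most \<open>k\<close> are again of category at most
  \<open>k\<close>: if the inclusion of \<open>U\<close> is null-homotopic, then so is \<open>g \<circ> f\<close> on the preimage of \<open>U\<close>, and
  \<open>g \<circ> f\<close> is homotopic to the identity. If \<open>z\<close> comes from the complement of the preimage of \<open>A\<close>, then by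
  functoriality its image comes from the complement of \<open>A\<close>. So the category weight increases weakly
  along both \<open>f\<close> and \<open>g\<close>, and the two weights agree because the composite induced map sends \<open>z\<close> to
  itself. This last fact is the homotopy invariance of homology with local coefficients, for which
  the coefficients are transported along the tracks of the homotopy; it follows from the classical
  prism operator \<open>P\<close>, which satisfies \<open>\<partial>P + P\<partial> = (g \<circ> f)\<^sub># - id\<close>.
\<close>

section \<open>Chain groups with local coefficients\<close>

lemma comm_group_sum_group:
  assumes "\<And>i. i \<in> I \<Longrightarrow> comm_group (G i)"
  shows "comm_group (sum_group I G)"
proof -
  have grp: "\<And>i. i \<in> I \<Longrightarrow> group (G i)"
    using assms comm_group_def by blast
  show ?thesis
  proof (rule group.group_comm_groupI[OF sum_group[OF grp]])
    fix x y
    assume "x \<in> carrier (sum_group I G)" "y \<in> carrier (sum_group I G)"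
    then have "x i \<in> carrier (G i)" "y i \<in> carrier (G i)" if "i \<in> I" for i
      using that grp by (auto simp: carrier_sum_group)
    then show "x \<otimes>\<^bsub>sum_group I G\<^esub> y = y \<otimes>\<^bsub>sum_group I G\<^esub> x"
      using assms by (auto simp: restrict_def fun_eq_iff comm_groupE(4))
  qed auto
qed

lemma local_systemD:
  assumes "local_system X R"
  shows "x \<in> topspace X \<Longrightarrow> comm_group (fibre R x)"
    and "pathin X p \<Longrightarrow> transport R p \<in> hom (fibre R (p 0)) (fibre R (p 1))"
    and "\<lbrakk>pathin X p; pathin X p'; p 1 = p' 0; r \<in> carrier (fibre R (p 0))\<rbrakk>
           \<Longrightarrow> transport R (path_concat p p') r = transport R p' (transport R p r)"
    and "\<lbrakk>path_homotopic X p p'; r \<in> carrier (fibre R (p 0))\<rbrakk>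
           \<Longrightarrow> transport R p r = transport R p' r"
  using assms unfolding local_system_def by (auto simp: iso_def)

lemma simplex_vertex0_in_standard_simplex: "simplex_vertex0 \<in> standard_simplex p"
  by (simp add: simplex_vertex0_def)

lemma singular_simplex_in_topspace:
  assumes "singular_simplex p X \<sigma>" "x \<in> standard_simplex p"
  shows "\<sigma> x \<in> topspace X"
  using assms by (auto simp: singular_simplex_def continuous_map_def Pi_iff)

lemma fibre_vertex0_comm_group:
  assumes "local_system X R" "singular_simplex q X \<sigma>"
  shows "comm_group (fibre R (\<sigma> simplex_vertex0))"
  using assms local_systemD(1) singular_simplex_in_topspace
    simplex_vertex0_in_standard_simplex by metis

lemma fibre_vertex0_group:
  assumes "local_system X R" "singular_simplex q X \<sigma>"
  shows "group (fibre R (\<sigma> simplex_vertex0))"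
  using fibre_vertex0_comm_group[OF assms] by (simp add: comm_group_def)

lemma comm_group_local_chain_group:
  assumes "local_system X R"
  shows "comm_group (local_chain_group q X R)"
  unfolding local_chain_group_def
  by (rule comm_group_sum_group) (use fibre_vertex0_comm_group[OF assms] in auto)

lemma carrier_local_chain_group:
  assumes "local_system X R"
  shows "c \<in> carrier (local_chain_group q X R) \<longleftrightarrow>
           c \<in> extensional (singular_simplex_set q X) \<and>
           (\<forall>\<sigma>. singular_simplex q X \<sigma> \<longrightarrow> c \<sigma> \<in> carrier (fibre R (\<sigma> simplex_vertex0))) \<and>
           finite (local_support q X R c)"
  unfolding local_chain_group_def local_support_def
  by (subst carrier_sum_group) (use fibre_vertex0_group[OF assms] in \<open>auto simp: PiE_iff\<close>)

lemma mult_local_chain_group: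
  "c \<otimes>\<^bsub>local_chain_group q X R\<^esub> d =
     (\<lambda>\<sigma>\<in>singular_simplex_set q X. c \<sigma> \<otimes>\<^bsub>fibre R (\<sigma> simplex_vertex0)\<^esub> d \<sigma>)"
  by (simp add: local_chain_group_def)

lemma one_local_chain_group:
  "\<one>\<^bsub>local_chain_group q X R\<^esub> =
     (\<lambda>\<sigma>\<in>singular_simplex_set q X. \<one>\<^bsub>fibre R (\<sigma> simplex_vertex0)\<^esub>)"
  by (simp add: local_chain_group_def)

lemma elementary_chain_hom:
  assumes R: "local_system X R" and \<sigma>: "singular_simplex q X \<sigma>"
  shows "(\<lambda>r. elementary_chain q X R r \<sigma>)
           \<in> hom (fibre R (\<sigma> simplex_vertex0)) (local_chain_group q X R)"
proof (rule homI)
  fix r assume r: "r \<in> carrier (fibre R (\<sigma> simplex_vertex0))"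
  have "local_support q X R (elementary_chain q X R r \<sigma>) \<subseteq> {\<sigma>}"
    by (auto simp: local_support_def elementary_chain_def)
  then have "finite (local_support q X R (elementary_chain q X R r \<sigma>))"
    using finite_subset by blast
  then show "elementary_chain q X R r \<sigma> \<in> carrier (local_chain_group q X R)"
    using r fibre_vertex0_group[OF R]
    by (auto simp: carrier_local_chain_group[OF R] elementary_chain_def
          group.is_monoid)
next
  fix r s
  have "\<one>\<^bsub>fibre R (\<tau> simplex_vertex0)\<^esub> \<otimes>\<^bsub>fibre R (\<tau> simplex_vertex0)\<^esub> \<one>\<^bsub>fibre R (\<tau> simplex_vertex0)\<^esub>
      = \<one>\<^bsub>fibre R (\<tau> simplex_vertex0)\<^esub>" if "singular_simplex q X \<tau>" for \<tau>
    using fibre_vertex0_group[OF R that] by (simp add: group.is_monoid)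
  then show "elementary_chain q X R (r \<otimes>\<^bsub>fibre R (\<sigma> simplex_vertex0)\<^esub> s) \<sigma> =
      elementary_chain q X R r \<sigma> \<otimes>\<^bsub>local_chain_group q X R\<^esub> elementary_chain q X R s \<sigma>"
    by (auto simp: elementary_chain_def mult_local_chain_group fun_eq_iff)
qed

lemma elementary_chain_in_carrier:
  assumes "local_system X R" "singular_simplex q X \<sigma>"
    and "r \<in> carrier (fibre R (\<sigma> simplex_vertex0))"
  shows "elementary_chain q X R r \<sigma> \<in> carrier (local_chain_group q X R)"
  using elementary_chain_hom[OF assms(1,2)] assms(3) by (auto simp: hom_def)

lemma fibrewise_extension_hom:
  assumes R: "local_system X R" and G: "comm_group G"
    and a: "\<And>\<sigma>. singular_simplex q X \<sigma> \<Longrightarrow> a \<sigma> \<in> hom (fibre R (\<sigma> simplex_vertex0)) G"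
  shows "(\<lambda>c. finprod G (\<lambda>\<sigma>. a \<sigma> (c \<sigma>)) (local_support q X R c)) \<in> hom (local_chain_group q X R) G"
proof -
  interpret G: comm_group G by fact
  let ?S = "singular_simplex_set q X"
  have eq: "finprod G (\<lambda>\<sigma>. a \<sigma> (c \<sigma>)) (local_support q X R c) = gfinprod G (\<lambda>\<sigma>. a \<sigma> (c \<sigma>)) ?S"
    if c: "c \<in> carrier (local_chain_group q X R)" for c
  proof -
    have fin: "finite (local_support q X R c)"
      and car: "\<And>\<sigma>. singular_simplex q X \<sigma> \<Longrightarrow> a \<sigma> (c \<sigma>) \<in> carrier G"
      using c hom_in_carrier[OF a] by (auto simp: carrier_local_chain_group[OF R])
    have one: "a \<sigma> (c \<sigma>) = \<one>\<^bsub>G\<^esub>" if "\<sigma> \<in> ?S - local_support q X R c" for \<sigma>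
    proof -
      have s: "singular_simplex q X \<sigma>" and "c \<sigma> = \<one>\<^bsub>fibre R (\<sigma> simplex_vertex0)\<^esub>"
        using that by (auto simp: local_support_def)
      then show ?thesis
        using hom_one[OF a[OF s] fibre_vertex0_group[OF R s] G.is_group] by simp
    qed
    have "finprod G (\<lambda>\<sigma>. a \<sigma> (c \<sigma>)) (local_support q X R c)
        = gfinprod G (\<lambda>\<sigma>. a \<sigma> (c \<sigma>)) (local_support q X R c)"
      using fin car by (intro G.gfinprod_eq_finprod[symmetric]) (auto simp: local_support_def)
    also have "\<dots> = gfinprod G (\<lambda>\<sigma>. a \<sigma> (c \<sigma>)) ?S"
      by (rule G.gfinprod_mono_neutral_cong_left) (use one car in \<open>auto simp: local_support_def\<close>)
    finally show ?thesis .
  qed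
  have "(\<lambda>c. gfinprod G (\<lambda>\<sigma>. a \<sigma> (c \<sigma>)) ?S) \<in> hom (local_chain_group q X R) G"
    unfolding local_chain_group_def
    by (rule G.hom_group_sum) (use a fibre_vertex0_group[OF R] in auto)
  moreover have "group (local_chain_group q X R)"
    using comm_group_local_chain_group[OF R] by (simp add: comm_group_def)
  ultimately show ?thesis
    using eq by (auto simp: hom_def Pi_iff group.is_monoid monoid.m_closed simp del: mult_sum_group)
qed

lemma fibrewise_extension_elementary_chain:
  assumes R: "local_system X R" and G: "comm_group G"
    and a: "a \<sigma> \<in> hom (fibre R (\<sigma> simplex_vertex0)) G"
    and \<sigma>: "singular_simplex q X \<sigma>" and r: "r \<in> carrier (fibre R (\<sigma> simplex_vertex0))"
  shows "finprod G (\<lambda>\<tau>. a \<tau> (elementary_chain q X R r \<sigma> \<tau>))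
           (local_support q X R (elementary_chain q X R r \<sigma>)) = a \<sigma> r"
proof -
  interpret G: comm_group G by fact
  have car: "a \<sigma> r \<in> carrier G" using a r by (auto simp: hom_def)
  show ?thesis
  proof (cases "r = \<one>\<^bsub>fibre R (\<sigma> simplex_vertex0)\<^esub>")
    case True
    then have "local_support q X R (elementary_chain q X R r \<sigma>) = {}"
      by (auto simp: local_support_def elementary_chain_def)
    then show ?thesis
      using True hom_one[OF a fibre_vertex0_group[OF R \<sigma>] G.is_group] by simp
  next
    case False
    then have "local_support q X R (elementary_chain q X R r \<sigma>) = {\<sigma>}"
      using \<sigma> by (auto simp: local_support_def elementary_chain_def)
    then show ?thesis
      using car \<sigma> by (simp add: elementary_chain_def)
  qed
qed

definition local_generators ::
    "nat \<Rightarrow> 'a topology \<Rightarrow> ('a, 'r) coeff_system \<Rightarrow> ('r \<times> ((nat \<Rightarrow> real) \<Rightarrow> 'a)) set" where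
  "local_generators q X R =
     {(r, \<sigma>). singular_simplex q X \<sigma> \<and> r \<in> carrier (fibre R (\<sigma> simplex_vertex0))}"

text \<open>
  Signed sums are awkward in \<open>local_chain_group\<close>, which is not an instance of a type class. Formal
  identities are therefore checked in the free abelian group on the pairs \<open>(r, \<sigma>)\<close> and pushed
  forward along \<open>realize\<close>.
\<close>

definition realize ::
    "nat \<Rightarrow> 'a topology \<Rightarrow> ('a, 'r) coeff_system \<Rightarrow> ('r \<times> ((nat \<Rightarrow> real) \<Rightarrow> 'a) \<Rightarrow>\<^sub>0 int)
       \<Rightarrow> ((nat \<Rightarrow> real) \<Rightarrow> 'a) \<Rightarrow> 'r" where
  "realize q X R =
     (SOME \<pi>. \<pi> \<in> hom (free_Abelian_group (local_generators q X R)) (local_chain_group q X R) \<and>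
        (\<forall>r \<sigma>. (r, \<sigma>) \<in> local_generators q X R \<longrightarrow>
           \<pi> (frag_of (r, \<sigma>)) = elementary_chain q X R r \<sigma>))"

lemma realize:
  assumes R: "local_system X R"
  shows realize_hom: "realize q X R
           \<in> hom (free_Abelian_group (local_generators q X R)) (local_chain_group q X R)"
    and realize_frag_of: "(r, \<sigma>) \<in> local_generators q X R \<Longrightarrow>
           realize q X R (frag_of (r, \<sigma>)) = elementary_chain q X R r \<sigma>"
proof -
  interpret C: comm_group "local_chain_group q X R"
    by (rule comm_group_local_chain_group[OF R])
  have "(\<lambda>(r, \<sigma>). elementary_chain q X R r \<sigma>) ` local_generators q X R
          \<subseteq> carrier (local_chain_group q X R)"
    by (auto simp: local_generators_def elementary_chain_in_carrier[OF R])
  then obtain \<pi> where \<pi>: "\<pi> \<in> hom (free_Abelian_group (local_generators q X R)) (local_chain_group q X R)"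
      "\<And>x. x \<in> local_generators q X R \<Longrightarrow> \<pi> (frag_of x) = (\<lambda>(r, \<sigma>). elementary_chain q X R r \<sigma>) x"
    by (rule C.free_Abelian_group_universal) blast
  then have "\<exists>\<pi>. \<pi> \<in> hom (free_Abelian_group (local_generators q X R)) (local_chain_group q X R) \<and>
        (\<forall>r \<sigma>. (r, \<sigma>) \<in> local_generators q X R \<longrightarrow>
           \<pi> (frag_of (r, \<sigma>)) = elementary_chain q X R r \<sigma>)"
    by auto
  from someI_ex[OF this]
  show "realize q X R \<in> hom (free_Abelian_group (local_generators q X R)) (local_chain_group q X R)"
    and "(r, \<sigma>) \<in> local_generators q X R \<Longrightarrow>
           realize q X R (frag_of (r, \<sigma>)) = elementary_chain q X R r \<sigma>"
    unfolding realize_def by blast+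
qed

lemma group_hom_realize:
  assumes "local_system X R"
  shows "group_hom (free_Abelian_group (local_generators q X R)) (local_chain_group q X R)
           (realize q X R)"
  using comm_group_local_chain_group[OF assms] realize_hom[OF assms]
  by (auto simp: group_hom_def group_hom_axioms_def comm_group_def)

lemma realize_diff:
  assumes R: "local_system X R"
    and "Poly_Mapping.keys u \<subseteq> local_generators q X R"
    and "Poly_Mapping.keys v \<subseteq> local_generators q X R"
  shows "realize q X R (u - v) =
           realize q X R u \<otimes>\<^bsub>local_chain_group q X R\<^esub> inv\<^bsub>local_chain_group q X R\<^esub> realize q X R v"
proof -
  interpret h: group_hom "free_Abelian_group (local_generators q X R)" "local_chain_group q X R" "realize q X R"
    by (rule group_hom_realize[OF R])
  have c: "u \<in> carrier (free_Abelian_group (local_generators q X R))"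
      "v \<in> carrier (free_Abelian_group (local_generators q X R))"
    using assms by auto
  have "realize q X R (u - v) = realize q X R (u \<otimes>\<^bsub>free_Abelian_group (local_generators q X R)\<^esub>
      inv\<^bsub>free_Abelian_group (local_generators q X R)\<^esub> v)"
    using assms by simp
  also have "\<dots> = realize q X R u \<otimes>\<^bsub>local_chain_group q X R\<^esub> inv\<^bsub>local_chain_group q X R\<^esub> realize q X R v"
    using c by (simp only: h.hom_mult h.G.inv_closed h.hom_inv)
  finally show ?thesis .
qed

lemma realize_sum:
  assumes R: "local_system X R"
    and "finite K" "\<And>k. k \<in> K \<Longrightarrow> g k \<in> local_generators q X R"
  shows "realize q X R (\<Sum>k\<in>K. frag_cmul (m k) (frag_of (g k))) =
           finprod (local_chain_group q X R)
             (\<lambda>k. elementary_chain q X R (fst (g k)) (snd (g k)) [^]\<^bsub>local_chain_group q X R\<^esub> m k) K"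
proof -
  interpret h: group_hom "free_Abelian_group (local_generators q X R)" "local_chain_group q X R" "realize q X R"
    by (rule group_hom_realize[OF R])
  interpret C: comm_group "local_chain_group q X R"
    by (rule comm_group_local_chain_group[OF R])
  have summand: "realize q X R (frag_cmul (m k) (frag_of (g k))) =
        elementary_chain q X R (fst (g k)) (snd (g k)) [^]\<^bsub>local_chain_group q X R\<^esub> m k"
    and keys: "Poly_Mapping.keys (frag_cmul (m k) (frag_of (g k))) \<subseteq> local_generators q X R"
    and closed: "elementary_chain q X R (fst (g k)) (snd (g k)) \<in> carrier (local_chain_group q X R)"
    if "g k \<in> local_generators q X R" for k
  proof -
    have "realize q X R (frag_cmul (m k) (frag_of (g k))) =
        realize q X R (frag_of (g k) [^]\<^bsub>free_Abelian_group (local_generators q X R)\<^esub> m k)"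
      using that by simp
    also have "\<dots> = realize q X R (frag_of (g k)) [^]\<^bsub>local_chain_group q X R\<^esub> m k"
      by (rule h.hom_int_pow) (use that in simp)
    also have "realize q X R (frag_of (g k)) = elementary_chain q X R (fst (g k)) (snd (g k))"
      using realize_frag_of[OF R, of "fst (g k)" "snd (g k)"] that by simp
    finally show "realize q X R (frag_cmul (m k) (frag_of (g k))) =
        elementary_chain q X R (fst (g k)) (snd (g k)) [^]\<^bsub>local_chain_group q X R\<^esub> m k" .
    show "Poly_Mapping.keys (frag_cmul (m k) (frag_of (g k))) \<subseteq> local_generators q X R"
      using that by auto
    show "elementary_chain q X R (fst (g k)) (snd (g k)) \<in> carrier (local_chain_group q X R)"
      using that elementary_chain_in_carrier[OF R] by (auto simp: local_generators_def)
  qed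
  show ?thesis
    using assms(2,3)
  proof (induction K)
    case empty
    then show ?case using h.hom_one by simp
  next
    case (insert k K)
    let ?t = "\<lambda>k. frag_cmul (m k) (frag_of (g k))"
    have ks: "Poly_Mapping.keys (sum ?t K) \<subseteq> local_generators q X R"
      using keys_sum[of ?t K] keys insert.prems by blast
    have "realize q X R (sum ?t (insert k K)) = realize q X R (?t k \<otimes>\<^bsub>free_Abelian_group (local_generators q X R)\<^esub> sum ?t K)"
      using insert by simp
    also have "\<dots> = realize q X R (?t k) \<otimes>\<^bsub>local_chain_group q X R\<^esub> realize q X R (sum ?t K)"
      using ks keys insert.prems by (intro h.hom_mult) (simp_all only: carrier_free_Abelian_group_iff insertI1)
    also have "\<dots> = finprod (local_chain_group q X R)
        (\<lambda>k. elementary_chain q X R (fst (g k)) (snd (g k)) [^]\<^bsub>local_chain_group q X R\<^esub> m k) (insert k K)"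
      using insert by (subst C.finprod_insert) (auto simp: summand closed simp del: mult_sum_group)
    finally show ?case .
  qed
qed

lemma realize_surj:
  assumes R: "local_system X R" and c: "c \<in> carrier (local_chain_group q X R)"
  obtains u where "Poly_Mapping.keys u \<subseteq> local_generators q X R" "realize q X R u = c"
proof -
  interpret h: group_hom "free_Abelian_group (local_generators q X R)" "local_chain_group q X R" "realize q X R"
    by (rule group_hom_realize[OF R])
  have "\<exists>u. Poly_Mapping.keys u \<subseteq> local_generators q X R \<and> realize q X R u = c"
    if "finite A" "c \<in> carrier (local_chain_group q X R)" "local_support q X R c \<subseteq> A" for A c
    using that
  proof (induction A arbitrary: c)
    case empty
    then have "\<And>\<sigma>. singular_simplex q X \<sigma> \<Longrightarrow> c \<sigma> = \<one>\<^bsub>fibre R (\<sigma> simplex_vertex0)\<^esub>"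
      by (auto simp: local_support_def)
    then have "c = \<one>\<^bsub>local_chain_group q X R\<^esub>"
      using empty.prems
      by (auto simp: one_local_chain_group carrier_local_chain_group[OF R] fun_eq_iff extensional_def)
    then show ?case
      using h.hom_one by (intro exI[of _ 0]) simp
  next
    case (insert \<sigma> A)
    show ?case
    proof (cases "\<sigma> \<in> local_support q X R c")
      case False
      then show ?thesis using insert by blast
    next
      case True
      then have \<sigma>: "singular_simplex q X \<sigma>" by (simp add: local_support_def)
      let ?d = "c(\<sigma> := \<one>\<^bsub>fibre R (\<sigma> simplex_vertex0)\<^esub>)"
      have cc: "c \<in> extensional (singular_simplex_set q X)"
          "\<And>\<tau>. singular_simplex q X \<tau> \<Longrightarrow> c \<tau> \<in> carrier (fibre R (\<tau> simplex_vertex0))"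
          "finite (local_support q X R c)"
        using insert.prems by (auto simp: carrier_local_chain_group[OF R])
      have sup: "local_support q X R ?d \<subseteq> A" "local_support q X R ?d \<subseteq> local_support q X R c"
        using insert.prems by (auto simp: local_support_def split: if_splits)
      have mon: "\<And>\<tau>. singular_simplex q X \<tau> \<Longrightarrow> monoid (fibre R (\<tau> simplex_vertex0))"
        using fibre_vertex0_group[OF R] group.is_monoid by blast
      have d: "?d \<in> carrier (local_chain_group q X R)"
        using cc \<sigma> finite_subset[OF sup(2)] mon
        by (auto simp: carrier_local_chain_group[OF R] extensional_def)
      obtain u where u: "Poly_Mapping.keys u \<subseteq> local_generators q X R" "realize q X R u = ?d"
        using insert.IH[OF d sup(1)] by blast
      have g: "(c \<sigma>, \<sigma>) \<in> local_generators q X R"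
        using cc \<sigma> by (simp add: local_generators_def)
      have "realize q X R (frag_of (c \<sigma>, \<sigma>) + u)
          = realize q X R (frag_of (c \<sigma>, \<sigma>)) \<otimes>\<^bsub>local_chain_group q X R\<^esub> realize q X R u"
        using h.hom_mult[of "frag_of (c \<sigma>, \<sigma>)" u] g u by simp
      also have "\<dots> = elementary_chain q X R (c \<sigma>) \<sigma> \<otimes>\<^bsub>local_chain_group q X R\<^esub> ?d"
        using realize_frag_of[OF R g] u by simp
      also have "\<dots> = c"
      proof
        fix \<tau>
        show "(elementary_chain q X R (c \<sigma>) \<sigma> \<otimes>\<^bsub>local_chain_group q X R\<^esub> ?d) \<tau> = c \<tau>"
          using cc \<sigma> mon
          by (cases "\<tau> = \<sigma>") (auto simp: mult_local_chain_group elementary_chain_def extensional_def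
              monoid.r_one monoid.l_one)
      qed
      finally show ?thesis
        using u g keys_add[of "frag_of (c \<sigma>, \<sigma>)" u] by (intro exI[of _ "frag_of (c \<sigma>, \<sigma>) + u"]) auto
    qed
  qed
  then show ?thesis
    using that c by (metis carrier_local_chain_group[OF R] order_refl)
qed

text \<open>
  The boundary, the maps induced by coefficient morphisms and the prism operator all have the form
  \<open>chain_op\<close>: each is an alternating sum of elementary chains.
\<close>

definition chain_op ::
    "nat \<Rightarrow> (nat \<Rightarrow> ((nat \<Rightarrow> real) \<Rightarrow> 'a) \<Rightarrow> 'r \<Rightarrow> 's)
       \<Rightarrow> (nat \<Rightarrow> ((nat \<Rightarrow> real) \<Rightarrow> 'a) \<Rightarrow> (nat \<Rightarrow> real) \<Rightarrow> 'b)
       \<Rightarrow> nat \<Rightarrow> 'a topology \<Rightarrow> ('a, 'r) coeff_system \<Rightarrow> nat \<Rightarrow> 'b topology \<Rightarrow> ('b, 's) coeff_system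
       \<Rightarrow> (((nat \<Rightarrow> real) \<Rightarrow> 'a) \<Rightarrow> 'r) \<Rightarrow> ((nat \<Rightarrow> real) \<Rightarrow> 'b) \<Rightarrow> 's" where
  "chain_op n \<alpha> \<tau> q X R p Y S c =
     finprod (local_chain_group p Y S)
       (\<lambda>\<sigma>. finprod (local_chain_group p Y S)
          (\<lambda>k. elementary_chain p Y S (\<alpha> k \<sigma> (c \<sigma>)) (\<tau> k \<sigma>)
                 [^]\<^bsub>local_chain_group p Y S\<^esub> ((- 1) ^ k :: int)) {..n})
       (local_support q X R c)"

definition frag_op ::
    "nat \<Rightarrow> (nat \<Rightarrow> ((nat \<Rightarrow> real) \<Rightarrow> 'a) \<Rightarrow> 'r \<Rightarrow> 's)
       \<Rightarrow> (nat \<Rightarrow> ((nat \<Rightarrow> real) \<Rightarrow> 'a) \<Rightarrow> (nat \<Rightarrow> real) \<Rightarrow> 'b)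
       \<Rightarrow> ('r \<times> ((nat \<Rightarrow> real) \<Rightarrow> 'a) \<Rightarrow>\<^sub>0 int) \<Rightarrow> ('s \<times> ((nat \<Rightarrow> real) \<Rightarrow> 'b) \<Rightarrow>\<^sub>0 int)" where
  "frag_op n \<alpha> \<tau> =
     frag_extend (\<lambda>(r, \<sigma>). \<Sum>k\<le>n. frag_cmul ((- 1) ^ k) (frag_of (\<alpha> k \<sigma> r, \<tau> k \<sigma>)))"

definition chain_op_data ::
    "nat \<Rightarrow> (nat \<Rightarrow> ((nat \<Rightarrow> real) \<Rightarrow> 'a) \<Rightarrow> 'r \<Rightarrow> 's)
       \<Rightarrow> (nat \<Rightarrow> ((nat \<Rightarrow> real) \<Rightarrow> 'a) \<Rightarrow> (nat \<Rightarrow> real) \<Rightarrow> 'b)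
       \<Rightarrow> nat \<Rightarrow> 'a topology \<Rightarrow> ('a, 'r) coeff_system
       \<Rightarrow> nat \<Rightarrow> 'b topology \<Rightarrow> ('b, 's) coeff_system \<Rightarrow> bool" where
  "chain_op_data n \<alpha> \<tau> q X R p Y S \<longleftrightarrow>
     (\<forall>\<sigma> k. singular_simplex q X \<sigma> \<longrightarrow> k \<le> n \<longrightarrow>
        singular_simplex p Y (\<tau> k \<sigma>) \<and>
        \<alpha> k \<sigma> \<in> hom (fibre R (\<sigma> simplex_vertex0)) (fibre S (\<tau> k \<sigma> simplex_vertex0)))"

context
  fixes n \<alpha> \<tau> q X R p Y S
  assumes R: "local_system X R" and S: "local_system Y S"
    and data: "chain_op_data n \<alpha> \<tau> q X R p Y S"
begin

lemma chain_op_generator: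
  assumes "(r, \<sigma>) \<in> local_generators q X R" "k \<le> n"
  shows "(\<alpha> k \<sigma> r, \<tau> k \<sigma>) \<in> local_generators p Y S"
  using data assms by (auto simp: chain_op_data_def local_generators_def intro: hom_in_carrier)

lemma keys_frag_op:
  assumes "Poly_Mapping.keys u \<subseteq> local_generators q X R"
  shows "Poly_Mapping.keys (frag_op n \<alpha> \<tau> u) \<subseteq> local_generators p Y S"
proof -
  have "Poly_Mapping.keys (\<Sum>k\<le>n. frag_cmul ((- 1) ^ k) (frag_of (\<alpha> k \<sigma> r, \<tau> k \<sigma>)))
      \<subseteq> local_generators p Y S" if "(r, \<sigma>) \<in> local_generators q X R" for r \<sigma>
    using chain_op_generator[OF that]
    by (intro order_trans[OF keys_sum]) auto
  then show ?thesis
    using assms unfolding frag_op_def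
    by (intro order_trans[OF keys_frag_extend]) fastforce
qed

lemma chain_op_fibre_hom:
  assumes \<sigma>: "singular_simplex q X \<sigma>"
  shows "(\<lambda>r. finprod (local_chain_group p Y S)
          (\<lambda>k. elementary_chain p Y S (\<alpha> k \<sigma> r) (\<tau> k \<sigma>)
                 [^]\<^bsub>local_chain_group p Y S\<^esub> ((- 1) ^ k :: int)) {..n})
         \<in> hom (fibre R (\<sigma> simplex_vertex0)) (local_chain_group p Y S)"
proof -
  interpret C: comm_group "local_chain_group p Y S"
    by (rule comm_group_local_chain_group[OF S])
  interpret F: group "fibre R (\<sigma> simplex_vertex0)"
    by (rule fibre_vertex0_group[OF R \<sigma>])
  have h: "(\<lambda>r. elementary_chain p Y S (\<alpha> k \<sigma> r) (\<tau> k \<sigma>))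
         \<in> hom (fibre R (\<sigma> simplex_vertex0)) (local_chain_group p Y S)" if "k \<le> n" for k
    using hom_compose[OF _ elementary_chain_hom[OF S, of p "\<tau> k \<sigma>"], of "\<alpha> k \<sigma>"] data \<sigma> that
    by (auto simp: chain_op_data_def o_def)
  show ?thesis
  proof (rule homI)
    fix r assume "r \<in> carrier (fibre R (\<sigma> simplex_vertex0))"
    then show "finprod (local_chain_group p Y S)
          (\<lambda>k. elementary_chain p Y S (\<alpha> k \<sigma> r) (\<tau> k \<sigma>)
                 [^]\<^bsub>local_chain_group p Y S\<^esub> ((- 1) ^ k :: int)) {..n} \<in> carrier (local_chain_group p Y S)"
      using hom_in_carrier[OF h] by (intro C.finprod_closed) auto
  next
    fix r s assume rs: "r \<in> carrier (fibre R (\<sigma> simplex_vertex0))" "s \<in> carrier (fibre R (\<sigma> simplex_vertex0))"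
    let ?e = "\<lambda>r k. elementary_chain p Y S (\<alpha> k \<sigma> r) (\<tau> k \<sigma>)"
    have c: "?e r k \<in> carrier (local_chain_group p Y S)" "?e s k \<in> carrier (local_chain_group p Y S)" if "k \<le> n" for k
      using hom_in_carrier[OF h] rs that by auto
    have eq: "?e (r \<otimes>\<^bsub>fibre R (\<sigma> simplex_vertex0)\<^esub> s) k [^]\<^bsub>local_chain_group p Y S\<^esub> ((- 1) ^ k :: int) =
        ?e r k [^]\<^bsub>local_chain_group p Y S\<^esub> ((- 1) ^ k :: int) \<otimes>\<^bsub>local_chain_group p Y S\<^esub>
        ?e s k [^]\<^bsub>local_chain_group p Y S\<^esub> ((- 1) ^ k :: int)" if "k \<le> n" for k
      using hom_mult[OF h[OF that] rs] C.int_pow_distrib[OF c[OF that]] by simp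
    have "finprod (local_chain_group p Y S)
          (\<lambda>k. ?e (r \<otimes>\<^bsub>fibre R (\<sigma> simplex_vertex0)\<^esub> s) k [^]\<^bsub>local_chain_group p Y S\<^esub> ((- 1) ^ k :: int)) {..n}
        = finprod (local_chain_group p Y S)
          (\<lambda>k. ?e r k [^]\<^bsub>local_chain_group p Y S\<^esub> ((- 1) ^ k :: int) \<otimes>\<^bsub>local_chain_group p Y S\<^esub>
               ?e s k [^]\<^bsub>local_chain_group p Y S\<^esub> ((- 1) ^ k :: int)) {..n}"
      by (rule C.finprod_cong') (use c eq in auto)
    also have "\<dots> = finprod (local_chain_group p Y S)
          (\<lambda>k. ?e r k [^]\<^bsub>local_chain_group p Y S\<^esub> ((- 1) ^ k :: int)) {..n} \<otimes>\<^bsub>local_chain_group p Y S\<^esub>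
        finprod (local_chain_group p Y S)
          (\<lambda>k. ?e s k [^]\<^bsub>local_chain_group p Y S\<^esub> ((- 1) ^ k :: int)) {..n}"
      by (rule C.finprod_multf) (use c in auto)
    finally show "finprod (local_chain_group p Y S)
          (\<lambda>k. ?e (r \<otimes>\<^bsub>fibre R (\<sigma> simplex_vertex0)\<^esub> s) k [^]\<^bsub>local_chain_group p Y S\<^esub> ((- 1) ^ k :: int)) {..n}
        = finprod (local_chain_group p Y S)
          (\<lambda>k. ?e r k [^]\<^bsub>local_chain_group p Y S\<^esub> ((- 1) ^ k :: int)) {..n} \<otimes>\<^bsub>local_chain_group p Y S\<^esub>
        finprod (local_chain_group p Y S)
          (\<lambda>k. ?e s k [^]\<^bsub>local_chain_group p Y S\<^esub> ((- 1) ^ k :: int)) {..n}" .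
  qed
qed

lemma chain_op_hom:
  "chain_op n \<alpha> \<tau> q X R p Y S \<in> hom (local_chain_group q X R) (local_chain_group p Y S)"
  unfolding chain_op_def
  by (rule fibrewise_extension_hom[OF R comm_group_local_chain_group[OF S],
        where a = "\<lambda>\<sigma> r. finprod (local_chain_group p Y S)
          (\<lambda>k. elementary_chain p Y S (\<alpha> k \<sigma> r) (\<tau> k \<sigma>)
                 [^]\<^bsub>local_chain_group p Y S\<^esub> ((- 1) ^ k :: int)) {..n}"])
     (rule chain_op_fibre_hom)

lemma chain_op_realize:
  assumes "Poly_Mapping.keys u \<subseteq> local_generators q X R"
  shows "chain_op n \<alpha> \<tau> q X R p Y S (realize q X R u) = realize p Y S (frag_op n \<alpha> \<tau> u)"
proof -
  interpret \<pi>: group_hom "free_Abelian_group (local_generators q X R)" "local_chain_group q X R" "realize q X R"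
    by (rule group_hom_realize[OF R])
  interpret \<pi>': group_hom "free_Abelian_group (local_generators p Y S)" "local_chain_group p Y S" "realize p Y S"
    by (rule group_hom_realize[OF S])
  interpret op: group_hom "local_chain_group q X R" "local_chain_group p Y S" "chain_op n \<alpha> \<tau> q X R p Y S"
    using chain_op_hom by unfold_locales
  show ?thesis
    using assms
  proof (induction rule: free_Abelian_group_induct[consumes 1])
    case 1
    then show ?case
      using \<pi>.hom_one \<pi>'.hom_one op.hom_one by (simp add: frag_op_def)
  next
    case (2 u v)
    have k: "Poly_Mapping.keys (frag_op n \<alpha> \<tau> u) \<subseteq> local_generators p Y S"
        "Poly_Mapping.keys (frag_op n \<alpha> \<tau> v) \<subseteq> local_generators p Y S"
      using 2 keys_frag_op by auto
    have "frag_op n \<alpha> \<tau> (u - v) = frag_op n \<alpha> \<tau> u - frag_op n \<alpha> \<tau> v"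
      by (simp add: frag_op_def frag_extend_diff)
    then show ?case
      using 2 k \<pi>.hom_closed
      by (simp add: realize_diff[OF R] realize_diff[OF S] del: mult_sum_group)
  next
    case (3 g)
    obtain r \<sigma> where g: "g = (r, \<sigma>)" by (cases g)
    have \<sigma>: "singular_simplex q X \<sigma>" "r \<in> carrier (fibre R (\<sigma> simplex_vertex0))"
      using 3 g by (auto simp: local_generators_def)
    have "chain_op n \<alpha> \<tau> q X R p Y S (elementary_chain q X R r \<sigma>) =
        finprod (local_chain_group p Y S)
          (\<lambda>k. elementary_chain p Y S (\<alpha> k \<sigma> r) (\<tau> k \<sigma>)
                 [^]\<^bsub>local_chain_group p Y S\<^esub> ((- 1) ^ k :: int)) {..n}"
      unfolding chain_op_def
      by (rule fibrewise_extension_elementary_chain[OF R comm_group_local_chain_group[OF S] _ \<sigma>,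
            where a = "\<lambda>\<sigma> r. finprod (local_chain_group p Y S)
              (\<lambda>k. elementary_chain p Y S (\<alpha> k \<sigma> r) (\<tau> k \<sigma>)
                 [^]\<^bsub>local_chain_group p Y S\<^esub> ((- 1) ^ k :: int)) {..n}"])
         (rule chain_op_fibre_hom[OF \<sigma>(1)])
    also have "\<dots> = realize p Y S (\<Sum>k\<le>n. frag_cmul ((- 1) ^ k) (frag_of (\<alpha> k \<sigma> r, \<tau> k \<sigma>)))"
      using chain_op_generator[of r \<sigma>] 3 g
      by (subst realize_sum[OF S]) auto
    finally show ?case
      using realize_frag_of[OF R] 3 g by (simp add: frag_op_def)
  qed
qed

end

section \<open>Faces and degeneracies of simplices\<close>

definition simplical_degeneracy :: "nat \<Rightarrow> (nat \<Rightarrow> real) \<Rightarrow> nat \<Rightarrow> real" where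
  "simplical_degeneracy i x =
     (\<lambda>j. if j < i then x j else if j = i then x i + x (Suc i) else x (Suc j))"

lemma simplical_degeneracy_in_standard_simplex:
  assumes "i \<le> p" "x \<in> standard_simplex (Suc p)"
  shows "simplical_degeneracy i x \<in> standard_simplex p"
proof -
  have x: "\<And>j. 0 \<le> x j" "\<And>j. j > Suc p \<Longrightarrow> x j = 0" "(\<Sum>j\<le>Suc p. x j) = 1"
    using assms by (auto simp: standard_simplex_def)
  let ?y = "simplical_degeneracy i x"
  have pos: "0 \<le> ?y j" for j
    using x by (simp add: simplical_degeneracy_def)
  have sum: "(\<Sum>j\<le>n. ?y j) = (\<Sum>j\<le>Suc n. x j)" if "i \<le> n" for n
    using that
  proof (induction n rule: dec_induct)
    case base
    have "(\<Sum>j\<le>i. ?y j) = (\<Sum>j<i. ?y j) + ?y i"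
      by (simp flip: lessThan_Suc_atMost)
    also have "\<dots> = (\<Sum>j<i. x j) + (x i + x (Suc i))"
      by (simp add: simplical_degeneracy_def)
    also have "\<dots> = (\<Sum>j\<le>Suc i. x j)"
      by (simp add: lessThan_Suc_atMost[symmetric])
    finally show ?case .
  next
    case (step n)
    then show ?case by (simp add: simplical_degeneracy_def)
  qed
  have zero: "?y j = 0" if "j > p" for j
    using that assms(1) x by (simp add: simplical_degeneracy_def)
  have "?y j \<le> 1" for j
  proof (cases "j \<le> p")
    case True
    then have "?y j \<le> (\<Sum>j\<le>p. ?y j)"
      using pos by (intro member_le_sum) auto
    then show ?thesis using sum[OF assms(1)] x by simp
  qed (use zero in auto)
  with pos zero sum[OF assms(1)] x show ?thesis
    by (auto simp: standard_simplex_def)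
qed

lemma continuous_map_simplical_degeneracy:
  assumes "i \<le> p"
  shows "continuous_map (subtopology (powertop_real UNIV) (standard_simplex (Suc p)))
           (subtopology (powertop_real UNIV) (standard_simplex p)) (simplical_degeneracy i)"
proof -
  have "continuous_map (powertop_real UNIV) euclideanreal (\<lambda>x. simplical_degeneracy i x j)" for j
    unfolding simplical_degeneracy_def
    by (cases "j < i"; cases "j = i")
      (auto intro!: continuous_map_add continuous_map_product_projection)
  then show ?thesis
    using simplical_degeneracy_in_standard_simplex[OF assms]
    by (auto simp: continuous_map_in_subtopology continuous_map_componentwise
          intro: continuous_map_from_subtopology)
qed

lemma simplical_degeneracy_face:
  shows "k < i \<Longrightarrow> simplical_degeneracy i (simplical_face k x) = simplical_face k (simplical_degeneracy (i - 1) x)"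
    and "simplical_degeneracy i (simplical_face i x) = x"
    and "simplical_degeneracy i (simplical_face (Suc i) x) = x"
    and "Suc i < k \<Longrightarrow> simplical_degeneracy i (simplical_face k x) = simplical_face (k - 1) (simplical_degeneracy i x)"
  by (auto simp: simplical_degeneracy_def simplical_face_def fun_eq_iff not_less
        less_Suc_eq Suc_diff_Suc numeral_2_eq_2)

lemma sum_simplical_face:
  fixes x :: "nat \<Rightarrow> real"
  shows "i < k \<Longrightarrow> sum (simplical_face k x) {..i} = sum x {..i}"
    and "k \<le> i \<Longrightarrow> sum (simplical_face k x) {..i} = sum x {..<i}"
proof -
  show "sum (simplical_face k x) {..i} = sum x {..i}" if "i < k"
    using that by (intro sum.cong) (auto simp: simplical_face_def)
  show "sum (simplical_face k x) {..i} = sum x {..<i}" if "k \<le> i"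
    using that
  proof (induction i rule: dec_induct)
    case base
    have "sum (simplical_face k x) {..k} = sum (simplical_face k x) {..<k} + simplical_face k x k"
      by (simp flip: lessThan_Suc_atMost)
    then show ?case by (simp add: simplical_face_def)
  next
    case (step i)
    then show ?case by (simp add: simplical_face_def)
  qed
qed

lemma simplex_edge01:
  assumes "t \<in> {0..1}" "1 \<le> p"
  shows "simplex_edge01 t \<in> standard_simplex p"
proof -
  have "(\<Sum>i\<le>p. simplex_edge01 t i) = (\<Sum>i\<in>{0,1}. simplex_edge01 t i)"
    using assms by (intro sum.mono_neutral_right) (auto simp: simplex_edge01_def)
  then show ?thesis
    using assms by (auto simp: standard_simplex_def simplex_edge01_def)
qed

lemma simplex_edge01_0: "simplex_edge01 0 = simplex_vertex0"
  by (auto simp: simplex_edge01_def simplex_vertex0_def)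

lemma simplical_face_vertex0:
  shows "simplical_face 0 simplex_vertex0 = simplex_edge01 1"
    and "0 < k \<Longrightarrow> simplical_face k simplex_vertex0 = simplex_vertex0"
  by (auto simp: simplical_face_def simplex_vertex0_def simplex_edge01_def fun_eq_iff)

lemma singular_face_apply:
  "x \<in> standard_simplex p \<Longrightarrow> singular_face (Suc p) k \<sigma> x = \<sigma> (simplical_face k x)"
  by (simp add: singular_face_def)

lemma pathin_simplex_edge01:
  assumes \<sigma>: "singular_simplex p X \<sigma>" and p: "1 \<le> p"
  shows "pathin X (\<lambda>t. \<sigma> (simplex_edge01 t))"
proof -
  have "continuous_map (top_of_set {0..1}) euclideanreal (\<lambda>t. simplex_edge01 t j)" for j
    unfolding simplex_edge01_def
    by (cases "j = 0"; cases "j = 1") (auto intro!: continuous_intros)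
  then have "continuous_map (top_of_set {0..1})
      (subtopology (powertop_real UNIV) (standard_simplex p)) simplex_edge01"
    using simplex_edge01 p by (auto simp: continuous_map_in_subtopology continuous_map_componentwise)
  from continuous_map_compose[OF this] \<sigma> show ?thesis
    by (auto simp: pathin_def singular_simplex_def o_def)
qed

text \<open>
  Paths are functions on all of \<open>real\<close>, so \<open>transport\<close> could a priori depend on their values outside
  the unit interval; a constant homotopy shows that it does not.
\<close>

lemma transport_cong:
  assumes R: "local_system X R" and p: "pathin X p"
    and eq: "\<And>t. t \<in> {0..1} \<Longrightarrow> p t = p' t" and r: "r \<in> carrier (fibre R (p 0))"
  shows "transport R p r = transport R p' r"
proof (rule local_systemD(4)[OF R, where p = p and p' = p'])
  show "r \<in> carrier (fibre R (p 0))" by fact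
  show "path_homotopic X p p'"
    unfolding path_homotopic_def
    by (rule homotopic_with_equal) (use p eq[symmetric] in \<open>auto simp: pathin_def\<close>)
qed

section \<open>The boundary and induced maps\<close>

definition face_coeff ::
    "('a, 'r) coeff_system \<Rightarrow> nat \<Rightarrow> ((nat \<Rightarrow> real) \<Rightarrow> 'a) \<Rightarrow> 'r \<Rightarrow> 'r" where
  "face_coeff R k \<sigma> r = (if k = 0 then transport R (\<lambda>t. \<sigma> (simplex_edge01 t)) r else r)"

lemma chain_op_data_boundary:
  assumes R: "local_system X R"
  shows "chain_op_data (Suc m) (face_coeff R) (singular_face (Suc m)) (Suc m) X R m X R"
  unfolding chain_op_data_def
proof (intro allI impI conjI)
  fix \<sigma> k assume \<sigma>: "singular_simplex (Suc m) X \<sigma>" and k: "k \<le> Suc m"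
  show "singular_simplex m X (singular_face (Suc m) k \<sigma>)"
    using singular_simplex_singular_face[OF \<sigma> _ k] by simp
  have v: "singular_face (Suc m) k \<sigma> simplex_vertex0 = \<sigma> (simplical_face k simplex_vertex0)"
    by (rule singular_face_apply[OF simplex_vertex0_in_standard_simplex])
  show "face_coeff R k \<sigma> \<in> hom (fibre R (\<sigma> simplex_vertex0))
          (fibre R (singular_face (Suc m) k \<sigma> simplex_vertex0))"
  proof (cases "k = 0")
    case True
    then show ?thesis
      using local_systemD(2)[OF R pathin_simplex_edge01[OF \<sigma>]] v
      by (simp add: face_coeff_def[abs_def] simplical_face_vertex0 simplex_edge01_0)
  next
    case False
    then show ?thesis
      using v by (simp add: face_coeff_def[abs_def] simplical_face_vertex0 hom_def)
  qed
qed

lemma local_boundary_Suc: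
  "local_boundary (Suc m) X R =
     chain_op (Suc m) (face_coeff R) (singular_face (Suc m)) (Suc m) X R m X R"
  by (simp add: local_boundary_def chain_op_def face_coeff_def fun_eq_iff)

lemma local_boundary_hom:
  assumes R: "local_system X R"
  shows "local_boundary q X R \<in> hom (local_chain_group q X R) (local_chain_group (q - 1) X R)"
proof (cases q)
  case 0
  interpret C: comm_group "local_chain_group 0 X R"
    by (rule comm_group_local_chain_group[OF R])
  show ?thesis
    using 0 by (auto simp: local_boundary_def hom_def simp del: one_sum_group mult_sum_group)
next
  case (Suc m)
  then show ?thesis
    using chain_op_hom[OF R R chain_op_data_boundary[OF R]] by (simp add: local_boundary_Suc)
qed

definition coeff_morphism ::
    "'a topology \<Rightarrow> ('a, 'r) coeff_system \<Rightarrow> 'b topology \<Rightarrow> ('b, 's) coeff_system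
       \<Rightarrow> ('a \<Rightarrow> 'b) \<Rightarrow> ('a \<Rightarrow> 'r \<Rightarrow> 's) \<Rightarrow> bool" where
  "coeff_morphism X R Y S f \<phi> \<longleftrightarrow>
     local_system X R \<and> local_system Y S \<and> continuous_map X Y f \<and>
     (\<forall>x \<in> topspace X. \<phi> x \<in> hom (fibre R x) (fibre S (f x))) \<and>
     (\<forall>p. pathin X p \<longrightarrow> (\<forall>r \<in> carrier (fibre R (p 0)).
        \<phi> (p 1) (transport R p r) = transport S (f \<circ> p) (\<phi> (p 0) r)))"

lemma coeff_morphismD:
  assumes "coeff_morphism X R Y S f \<phi>"
  shows "local_system X R" "local_system Y S" "continuous_map X Y f"
    and "x \<in> topspace X \<Longrightarrow> \<phi> x \<in> hom (fibre R x) (fibre S (f x))"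
    and "\<lbrakk>pathin X p; r \<in> carrier (fibre R (p 0))\<rbrakk> \<Longrightarrow>
           \<phi> (p 1) (transport R p r) = transport S (f \<circ> p) (\<phi> (p 0) r)"
  using assms by (auto simp: coeff_morphism_def)

lemma coeff_morphism_subtopology:
  assumes fR: "coeff_morphism X R Y S f \<phi>" and U: "f ` (topspace X \<inter> U) \<subseteq> V"
  shows "coeff_morphism (subtopology X U) R (subtopology Y V) S f \<phi>"
  using assms local_system_subtopology[of X R U] local_system_subtopology[of Y S V]
  by (auto simp: coeff_morphism_def pathin_subtopology continuous_map_in_subtopology
        intro: continuous_map_from_subtopology)

lemma coeff_morphism_into_subtopology:
  assumes "local_system X R"
  shows "coeff_morphism (subtopology X U) R X R id (\<lambda>x. id)"
  using assms local_system_subtopology[OF assms]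
  by (auto simp: coeff_morphism_def hom_def intro: continuous_map_from_subtopology)

lemma simplex_map_vertex0: "simplex_map q f \<sigma> simplex_vertex0 = f (\<sigma> simplex_vertex0)"
  by (simp add: simplex_map_def simplex_vertex0_in_standard_simplex)

context
  fixes X :: "'a topology" and R :: "('a, 'r) coeff_system"
    and Y :: "'b topology" and S :: "('b, 's) coeff_system" and f \<phi>
  assumes f\<phi>: "coeff_morphism X R Y S f \<phi>"
begin

lemma chain_op_data_chain_map:
  "chain_op_data 0 (\<lambda>k \<sigma>. \<phi> (\<sigma> simplex_vertex0)) (\<lambda>k. simplex_map q f) q X R q Y S"
  unfolding chain_op_data_def
  using coeff_morphismD(3)[OF f\<phi>]
    coeff_morphismD(4)[OF f\<phi> singular_simplex_in_topspace[OF _ simplex_vertex0_in_standard_simplex]]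
  by (auto simp: simplex_map_vertex0 intro: singular_simplex_simplex_map)

lemma local_chain_map_eq_chain_op:
  assumes c: "c \<in> carrier (local_chain_group q X R)"
  shows "local_chain_map q X R Y S f \<phi> c =
           chain_op 0 (\<lambda>k \<sigma>. \<phi> (\<sigma> simplex_vertex0)) (\<lambda>k. simplex_map q f) q X R q Y S c"
proof -
  interpret C: comm_group "local_chain_group q Y S"
    by (rule comm_group_local_chain_group[OF coeff_morphismD(2)[OF f\<phi>]])
  have "elementary_chain q Y S (\<phi> (\<sigma> simplex_vertex0) (c \<sigma>)) (simplex_map q f \<sigma>)
          \<in> carrier (local_chain_group q Y S)" if "\<sigma> \<in> local_support q X R c" for \<sigma>
  proof (rule elementary_chain_in_carrier[OF coeff_morphismD(2)[OF f\<phi>]])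
    have \<sigma>: "singular_simplex q X \<sigma>" using that by (simp add: local_support_def)
    then show "singular_simplex q Y (simplex_map q f \<sigma>)"
      using chain_op_data_chain_map by (auto simp: chain_op_data_def)
    show "\<phi> (\<sigma> simplex_vertex0) (c \<sigma>) \<in> carrier (fibre S (simplex_map q f \<sigma> simplex_vertex0))"
      using chain_op_data_chain_map[of q] \<sigma> c
      by (auto simp: chain_op_data_def carrier_local_chain_group[OF coeff_morphismD(1)[OF f\<phi>]]
            intro: hom_in_carrier)
  qed
  then show ?thesis
    unfolding local_chain_map_def chain_op_def by (intro C.finprod_cong') auto
qed

lemma local_chain_map_hom:
  "local_chain_map q X R Y S f \<phi> \<in> hom (local_chain_group q X R) (local_chain_group q Y S)"
proof -
  interpret C: comm_group "local_chain_group q X R"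
    by (rule comm_group_local_chain_group[OF coeff_morphismD(1)[OF f\<phi>]])
  have "chain_op 0 (\<lambda>k \<sigma>. \<phi> (\<sigma> simplex_vertex0)) (\<lambda>k. simplex_map q f) q X R q Y S
      \<in> hom (local_chain_group q X R) (local_chain_group q Y S)"
    by (rule chain_op_hom[OF coeff_morphismD(1,2)[OF f\<phi>] chain_op_data_chain_map])
  then show ?thesis
    by (auto simp: hom_def Pi_iff local_chain_map_eq_chain_op C.m_closed simp del: mult_sum_group)
qed

lemma local_chain_map_realize:
  assumes u: "Poly_Mapping.keys u \<subseteq> local_generators q X R"
  shows "local_chain_map q X R Y S f \<phi> (realize q X R u) =
    realize q Y S (frag_op 0 (\<lambda>k \<sigma>. \<phi> (\<sigma> simplex_vertex0)) (\<lambda>k. simplex_map q f) u)"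
  using chain_op_realize[OF coeff_morphismD(1,2)[OF f\<phi>] chain_op_data_chain_map u]
    hom_in_carrier[OF realize_hom[OF coeff_morphismD(1)[OF f\<phi>]]] u
  by (subst local_chain_map_eq_chain_op) auto

lemma frag_op_chain_map_boundary:
  assumes "Poly_Mapping.keys u \<subseteq> local_generators (Suc m) X R"
  shows "frag_op (Suc m) (face_coeff S) (singular_face (Suc m))
           (frag_op 0 (\<lambda>k \<sigma>. \<phi> (\<sigma> simplex_vertex0)) (\<lambda>k. simplex_map (Suc m) f) u) =
         frag_op 0 (\<lambda>k \<sigma>. \<phi> (\<sigma> simplex_vertex0)) (\<lambda>k. simplex_map m f)
           (frag_op (Suc m) (face_coeff R) (singular_face (Suc m)) u)"
  using assms
proof (induction rule: free_Abelian_group_induct[consumes 1])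
  case (3 g)
  obtain r \<sigma> where g: "g = (r, \<sigma>)" by (cases g)
  have \<sigma>: "singular_simplex (Suc m) X \<sigma>" and r: "r \<in> carrier (fibre R (\<sigma> simplex_vertex0))"
    using 3 g by (auto simp: local_generators_def)
  have face: "singular_face (Suc m) k (simplex_map (Suc m) f \<sigma>) = simplex_map m f (singular_face (Suc m) k \<sigma>)"
    if "k \<le> Suc m" for k
    using that simplical_face_in_standard_simplex[of "Suc m" k]
    by (auto simp: singular_face_def simplex_map_def fun_eq_iff)
  let ?p = "\<lambda>t. \<sigma> (simplex_edge01 t)"
  have p: "pathin X ?p" using pathin_simplex_edge01[OF \<sigma>] by simp
  have coeff: "face_coeff S k (simplex_map (Suc m) f \<sigma>) (\<phi> (\<sigma> simplex_vertex0) r) =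
      \<phi> (singular_face (Suc m) k \<sigma> simplex_vertex0) (face_coeff R k \<sigma> r)" if "k \<le> Suc m" for k
  proof (cases "k = 0")
    case True
    have p0: "?p 0 = \<sigma> simplex_vertex0" by (simp add: simplex_edge01_0)
    have "transport S (f \<circ> ?p) (\<phi> (?p 0) r) =
        transport S (\<lambda>t. simplex_map (Suc m) f \<sigma> (simplex_edge01 t)) (\<phi> (?p 0) r)"
    proof (rule transport_cong[OF coeff_morphismD(2)[OF f\<phi>]])
      show "pathin Y (f \<circ> ?p)"
        using pathin_compose[OF p coeff_morphismD(3)[OF f\<phi>]] .
      show "\<phi> (?p 0) r \<in> carrier (fibre S ((f \<circ> ?p) 0))"
        using hom_in_carrier[OF coeff_morphismD(4)[OF f\<phi> path_start_in_topspace[OF p]]] r p0 by simp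
    qed (simp add: simplex_map_def simplex_edge01)
    moreover have "\<phi> (?p 1) (transport R ?p r) = transport S (f \<circ> ?p) (\<phi> (?p 0) r)"
      using coeff_morphismD(5)[OF f\<phi> p] r p0 by simp
    ultimately show ?thesis
      using True p0
      by (simp add: face_coeff_def singular_face_apply simplex_vertex0_in_standard_simplex
            simplical_face_vertex0)
  next
    case False
    then show ?thesis
      by (simp add: face_coeff_def singular_face_apply simplex_vertex0_in_standard_simplex
            simplical_face_vertex0)
  qed
  show ?case
    by (simp add: g frag_op_def frag_extend_sum frag_extend_cmul o_def face coeff
          del: sum.atMost_Suc cong: sum.cong_simp)
qed (simp_all add: frag_op_def frag_extend_diff)

lemma local_boundary_chain_map:
  assumes c: "c \<in> carrier (local_chain_group q X R)"
  shows "local_boundary q Y S (local_chain_map q X R Y S f \<phi> c) =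
         local_chain_map (q - 1) X R Y S f \<phi> (local_boundary q X R c)"
proof (cases q)
  case 0
  have "group (local_chain_group 0 X R)" "group (local_chain_group 0 Y S)"
    using comm_group_local_chain_group coeff_morphismD(1,2)[OF f\<phi>] by (auto simp: comm_group_def)
  then show ?thesis
    using 0 hom_one[OF local_chain_map_hom, of 0] by (simp add: local_boundary_def del: one_sum_group)
next
  case (Suc m)
  note R = coeff_morphismD(1)[OF f\<phi>] and S = coeff_morphismD(2)[OF f\<phi>]
  obtain u where u: "Poly_Mapping.keys u \<subseteq> local_generators q X R" "realize q X R u = c"
    using realize_surj[OF R c] .
  note u' = u[unfolded Suc]
  note k1 = keys_frag_op[OF R S chain_op_data_chain_map u'(1)]
    and k2 = keys_frag_op[OF R R chain_op_data_boundary[OF R] u'(1)]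
  show ?thesis
    using chain_op_realize[OF S S chain_op_data_boundary[OF S] k1]
      chain_op_realize[OF R R chain_op_data_boundary[OF R] u'(1)]
      frag_op_chain_map_boundary[OF u'(1)]
      local_chain_map_realize[OF u'(1)] local_chain_map_realize[OF k2]
    by (simp add: Suc local_boundary_Suc flip: u'(2))
qed

end

lemma local_chain_map_compose:
  assumes f: "coeff_morphism X R Y S f \<phi>" and g: "coeff_morphism Y S Z T g \<psi>"
    and k: "coeff_morphism X R Z T (g \<circ> f) (\<lambda>x. \<psi> (f x) \<circ> \<phi> x)"
    and c: "c \<in> carrier (local_chain_group q X R)"
  shows "local_chain_map q Y S Z T g \<psi> (local_chain_map q X R Y S f \<phi> c) =
         local_chain_map q X R Z T (g \<circ> f) (\<lambda>x. \<psi> (f x) \<circ> \<phi> x) c"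
proof -
  obtain u where u: "Poly_Mapping.keys u \<subseteq> local_generators q X R" "realize q X R u = c"
    using realize_surj[OF coeff_morphismD(1)[OF f] c] .
  have comp: "simplex_map q g (simplex_map q f \<sigma>) = simplex_map q (\<lambda>x. g (f x)) \<sigma>" for \<sigma>
    by (auto simp: simplex_map_def)
  have "frag_op 0 (\<lambda>k \<sigma>. \<psi> (\<sigma> simplex_vertex0)) (\<lambda>k. simplex_map q g)
          (frag_op 0 (\<lambda>k \<sigma>. \<phi> (\<sigma> simplex_vertex0)) (\<lambda>k. simplex_map q f) u) =
        frag_op 0 (\<lambda>k \<sigma>. (\<psi> (f (\<sigma> simplex_vertex0)) \<circ> \<phi> (\<sigma> simplex_vertex0))) (\<lambda>k. simplex_map q (g \<circ> f)) u"
    using u(1)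
    by (induction rule: free_Abelian_group_induct[consumes 1])
       (auto simp: frag_op_def frag_extend_diff simplex_map_vertex0 comp)
  then show ?thesis
    using local_chain_map_realize[OF f u(1)] local_chain_map_realize[OF k u(1)] u(2)
      local_chain_map_realize[OF g keys_frag_op[OF coeff_morphismD(1,2)[OF f] chain_op_data_chain_map[OF f] u(1)]]
    by simp
qed

lemma coeff_morphism_compose:
  assumes f: "coeff_morphism X R Y S f \<phi>" and g: "coeff_morphism Y S Z T g \<psi>"
  shows "coeff_morphism X R Z T (g \<circ> f) (\<lambda>x. \<psi> (f x) \<circ> \<phi> x)"
proof -
  have "\<psi> (f x) \<circ> \<phi> x \<in> hom (fibre R x) (fibre T ((g \<circ> f) x))" if x: "x \<in> topspace X" for x
  proof -
    have "f x \<in> topspace Y" using x coeff_morphismD(3)[OF f] by (auto simp: continuous_map_def)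
    from hom_compose[OF coeff_morphismD(4)[OF f x] coeff_morphismD(4)[OF g this]]
    show ?thesis by simp
  qed
  moreover have "(\<psi> (f (p 1)) \<circ> \<phi> (p 1)) (transport R p r) =
      transport T ((g \<circ> f) \<circ> p) ((\<psi> (f (p 0)) \<circ> \<phi> (p 0)) r)"
    if p: "pathin X p" and r: "r \<in> carrier (fibre R (p 0))" for p r
    using coeff_morphismD(5)[OF f p r]
      coeff_morphismD(5)[OF g pathin_compose[OF p coeff_morphismD(3)[OF f]], of "\<phi> (p 0) r"]
      hom_in_carrier[OF coeff_morphismD(4)[OF f path_start_in_topspace[OF p]] r]
    by (simp add: o_assoc)
  ultimately show ?thesis
    using coeff_morphismD(1,3)[OF f] coeff_morphismD(2,3)[OF g]
    by (auto simp: coeff_morphism_def intro: continuous_map_compose)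
qed

section \<open>The prism operator\<close>

text \<open>
  Here \<open>a i k\<close> stands for face \<open>k\<close> of the \<open>i\<close>-th prism simplex over \<open>\<sigma>\<close>, and \<open>b i k\<close> for the \<open>i\<close>-th
  prism simplex over face \<open>k\<close> of \<open>\<sigma>\<close>.
\<close>

lemma alternating_prism_sum:
  fixes a b :: "nat \<Rightarrow> nat \<Rightarrow> 'c \<Rightarrow>\<^sub>0 int"
  assumes lower: "\<And>i k. \<lbrakk>k < i; i \<le> Suc m\<rbrakk> \<Longrightarrow> a i k = b (i - 1) k"
    and upper: "\<And>i k. \<lbrakk>Suc i < k; k \<le> Suc (Suc m)\<rbrakk> \<Longrightarrow> a i k = b i (k - 1)"
    and diag: "\<And>i. \<lbrakk>0 < i; i \<le> Suc m\<rbrakk> \<Longrightarrow> a i i = a (i - 1) i"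
  shows "(\<Sum>i\<le>Suc m. \<Sum>k\<le>Suc (Suc m). frag_cmul ((- 1) ^ (i + k)) (a i k)) =
           a 0 0 - a (Suc m) (Suc (Suc m))
             - (\<Sum>k\<le>Suc m. \<Sum>i\<le>m. frag_cmul ((- 1) ^ (i + k)) (b i k))"
proof -
  define A where "A i k = frag_cmul ((- 1) ^ (i + k)) (a i k)" for i k
  define B where "B i k = frag_cmul ((- 1) ^ (i + k)) (b i k)" for i k
  have split: "(\<Sum>k\<le>Suc (Suc m). A i k) =
      (\<Sum>k<i. A i k) + (A i i + A i (Suc i)) + (\<Sum>k\<in>{Suc i<..Suc (Suc m)}. A i k)" if "i \<le> Suc m" for i
  proof -
    have "{..Suc (Suc m)} = {..<i} \<union> {i, Suc i} \<union> {Suc i<..Suc (Suc m)}"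
      using that by auto
    moreover have "(\<Sum>k\<in>{..<i} \<union> {i, Suc i} \<union> {Suc i<..Suc (Suc m)}. A i k) =
        (\<Sum>k\<in>{..<i} \<union> {i, Suc i}. A i k) + (\<Sum>k\<in>{Suc i<..Suc (Suc m)}. A i k)"
      by (rule sum.union_disjoint) auto
    moreover have "(\<Sum>k\<in>{..<i} \<union> {i, Suc i}. A i k) = (\<Sum>k<i. A i k) + (\<Sum>k\<in>{i, Suc i}. A i k)"
      by (rule sum.union_disjoint) auto
    ultimately show ?thesis by simp
  qed
  have low: "(\<Sum>i\<le>Suc m. \<Sum>k<i. A i k) = - (\<Sum>i\<le>m. \<Sum>k\<le>i. B i k)"
  proof -
    have "(\<Sum>i\<le>Suc m. \<Sum>k<i. A i k) = (\<Sum>i\<le>m. \<Sum>k<Suc i. A (Suc i) k)"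
      by (subst sum.atMost_Suc_shift) simp
    also have "\<dots> = (\<Sum>i\<le>m. \<Sum>k\<le>i. - B i k)"
      by (intro sum.cong) (auto simp: A_def B_def lower)
    finally show ?thesis by (simp add: sum_negf)
  qed
  have up: "(\<Sum>k\<in>{Suc i<..Suc (Suc m)}. A i k) = - (\<Sum>k\<in>{i<..Suc m}. B i k)" for i
  proof -
    have "(\<Sum>k\<in>{Suc i<..Suc (Suc m)}. A i k) = (\<Sum>k\<in>{i<..Suc m}. A i (Suc k))"
      by (rule sum.reindex_bij_witness[of _ Suc "\<lambda>k. k - 1"]) auto
    also have "\<dots> = (\<Sum>k\<in>{i<..Suc m}. - B i k)"
      by (intro sum.cong) (auto simp: A_def B_def upper)
    finally show ?thesis by (simp add: sum_negf)
  qed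
  have tel: "(\<Sum>i\<le>n. A i i + A i (Suc i)) = a 0 0 - a n (Suc n)" if "n \<le> Suc m" for n
    using that
  proof (induction n)
    case 0
    then show ?case by (simp add: A_def)
  next
    case (Suc n)
    then show ?case using diag[of "Suc n"] by (simp add: A_def)
  qed
  have BB: "(\<Sum>k\<le>i. B i k) + (\<Sum>k\<in>{i<..Suc m}. B i k) = (\<Sum>k\<le>Suc m. B i k)" if "i \<le> m" for i
  proof -
    have "{..Suc m} = {..i} \<union> {i<..Suc m}" using that by auto
    then show ?thesis by (simp only:) (rule sum.union_disjoint[symmetric]; auto)
  qed
  have "(\<Sum>i\<le>Suc m. \<Sum>k\<le>Suc (Suc m). A i k) =
      (\<Sum>i\<le>Suc m. (\<Sum>k<i. A i k) + (A i i + A i (Suc i)) + (\<Sum>k\<in>{Suc i<..Suc (Suc m)}. A i k))"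
    using split by (intro sum.cong) auto
  also have "\<dots> = (\<Sum>i\<le>Suc m. \<Sum>k<i. A i k) + (\<Sum>i\<le>Suc m. A i i + A i (Suc i))
      + (\<Sum>i\<le>Suc m. \<Sum>k\<in>{Suc i<..Suc (Suc m)}. A i k)"
    by (simp only: sum.distrib)
  also have "(\<Sum>i\<le>Suc m. \<Sum>k\<in>{Suc i<..Suc (Suc m)}. A i k) = - (\<Sum>i\<le>m. \<Sum>k\<in>{i<..Suc m}. B i k)"
    by (simp only: up sum.atMost_Suc) (simp add: sum_negf)
  also have "(\<Sum>i\<le>Suc m. A i i + A i (Suc i)) = a 0 0 - a (Suc m) (Suc (Suc m))"
    by (rule tel) simp
  also have "(\<Sum>i\<le>Suc m. \<Sum>k<i. A i k) + (a 0 0 - a (Suc m) (Suc (Suc m)))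
      + - (\<Sum>i\<le>m. \<Sum>k\<in>{i<..Suc m}. B i k)
      = a 0 0 - a (Suc m) (Suc (Suc m)) - (\<Sum>i\<le>m. (\<Sum>k\<le>i. B i k) + (\<Sum>k\<in>{i<..Suc m}. B i k))"
    unfolding low sum.distrib by simp
  also have "(\<Sum>i\<le>m. (\<Sum>k\<le>i. B i k) + (\<Sum>k\<in>{i<..Suc m}. B i k)) = (\<Sum>i\<le>m. \<Sum>k\<le>Suc m. B i k)"
    using BB by (intro sum.cong) auto
  also have "\<dots> = (\<Sum>k\<le>Suc m. \<Sum>i\<le>m. B i k)"
    by (rule sum.swap)
  finally show ?thesis unfolding A_def B_def .
qed

text \<open>
  The affine simplex in \<open>\<Delta>\<^sup>p \<times> [0,1]\<close> that sends vertex \<open>j \<le> i\<close> to \<open>(e\<^sub>j, 0)\<close> and vertex \<open>j > i\<close> to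
  \<open>(e\<^sub>j\<^sub>-\<^sub>1, 1)\<close>. Its leading vertex lies at time 0, so the prism operator keeps coefficients unchanged;
  only the edge from vertex 0 to vertex 1 of the simplex \<open>i = 0\<close> follows the homotopy, and it
  contributes the transport along the track of the homotopy.
\<close>

definition homotopy_prism ::
    "(real \<times> 'a \<Rightarrow> 'b) \<Rightarrow> nat \<Rightarrow> nat \<Rightarrow> ((nat \<Rightarrow> real) \<Rightarrow> 'a) \<Rightarrow> (nat \<Rightarrow> real) \<Rightarrow> 'b" where
  "homotopy_prism h p i \<sigma> =
     (\<lambda>x\<in>standard_simplex (Suc p). h (1 - sum x {..i}, \<sigma> (simplical_degeneracy i x)))"

lemma sum_standard_simplex_01:
  assumes "x \<in> standard_simplex p"
  shows "sum x {..i} \<in> {0..1}"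
proof -
  have x: "\<And>j. 0 \<le> x j" "\<And>j. j > p \<Longrightarrow> x j = 0" "(\<Sum>j\<le>p. x j) = 1"
    using assms by (auto simp: standard_simplex_def)
  have "sum x {..i} \<le> sum x {..max i p}"
    using x by (intro sum_mono2) auto
  also have "\<dots> = sum x {..p}"
    using x by (intro sum.mono_neutral_right) auto
  finally show ?thesis using x by (auto intro: sum_nonneg)
qed

context
  fixes X :: "'a topology" and R :: "('a, 'r) coeff_system" and h :: "real \<times> 'a \<Rightarrow> 'a"
    and f :: "'a \<Rightarrow> 'a"
  assumes R: "local_system X R"
    and h: "continuous_map (prod_topology (top_of_set {0..1}) X) X h"
    and h0: "\<And>x. x \<in> topspace X \<Longrightarrow> h (0, x) = x"
    and h1: "\<And>x. x \<in> topspace X \<Longrightarrow> h (1, x) = f x"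
begin

lemma singular_simplex_homotopy_prism:
  assumes \<sigma>: "singular_simplex p X \<sigma>" and i: "i \<le> p"
  shows "singular_simplex (Suc p) X (homotopy_prism h p i \<sigma>)"
proof -
  let ?D = "subtopology (powertop_real UNIV) (standard_simplex (Suc p))"
  have "continuous_map (powertop_real UNIV) euclideanreal (\<lambda>x. 1 - sum x {..i})"
    by (intro continuous_map_diff continuous_map_sum continuous_map_product_projection) auto
  then have "continuous_map ?D (top_of_set {0..1}) (\<lambda>x. 1 - sum x {..i})"
    using sum_standard_simplex_01[of _ "Suc p" i]
    by (auto simp: continuous_map_in_subtopology intro: continuous_map_from_subtopology)
  moreover have "continuous_map ?D X (\<sigma> \<circ> simplical_degeneracy i)"
    by (rule continuous_map_compose[OF continuous_map_simplical_degeneracy[OF i]])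
      (use \<sigma> in \<open>simp add: singular_simplex_def\<close>)
  ultimately have "continuous_map ?D (prod_topology (top_of_set {0..1}) X)
      (\<lambda>x. (1 - sum x {..i}, \<sigma> (simplical_degeneracy i x)))"
    by (simp add: continuous_map_pairedI o_def)
  from continuous_map_compose[OF this h]
  have "continuous_map ?D X (\<lambda>x. h (1 - sum x {..i}, \<sigma> (simplical_degeneracy i x)))"
    by (simp add: o_def)
  then show ?thesis
    unfolding singular_simplex_def homotopy_prism_def
    by (auto intro: continuous_map_eq)
qed

lemma homotopy_prism_vertex0:
  assumes \<sigma>: "singular_simplex p X \<sigma>"
  shows "homotopy_prism h p i \<sigma> simplex_vertex0 = \<sigma> simplex_vertex0"
proof -
  have "sum simplex_vertex0 {..i} = 1"
    by (simp add: simplex_vertex0_def)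
  moreover have "simplical_degeneracy i simplex_vertex0 = simplex_vertex0"
    by (auto simp: simplical_degeneracy_def simplex_vertex0_def)
  ultimately show ?thesis
    using h0 singular_simplex_in_topspace[OF \<sigma> simplex_vertex0_in_standard_simplex]
    by (simp add: homotopy_prism_def simplex_vertex0_in_standard_simplex)
qed

lemma chain_op_data_prism:
  "chain_op_data p (\<lambda>i \<sigma> r. r) (homotopy_prism h p) p X R (Suc p) X R"
  unfolding chain_op_data_def
  using singular_simplex_homotopy_prism homotopy_prism_vertex0 by (auto simp: hom_def)

lemma homotopy_prism_edge01:
  assumes \<sigma>: "singular_simplex p X \<sigma>" and t: "t \<in> {0..1}"
  shows "homotopy_prism h p 0 \<sigma> (simplex_edge01 t) = h (t, \<sigma> simplex_vertex0)"
    and "\<lbrakk>0 < i; i \<le> p\<rbrakk> \<Longrightarrow> homotopy_prism h p i \<sigma> (simplex_edge01 t) = \<sigma> (simplex_edge01 t)"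
proof -
  have e: "simplex_edge01 t \<in> standard_simplex (Suc p)"
    using simplex_edge01[OF t] by simp
  have "simplical_degeneracy 0 (simplex_edge01 t) = simplex_vertex0"
    by (auto simp: simplical_degeneracy_def simplex_vertex0_def simplex_edge01_def)
  then show "homotopy_prism h p 0 \<sigma> (simplex_edge01 t) = h (t, \<sigma> simplex_vertex0)"
    using e by (simp add: homotopy_prism_def) (simp add: simplex_edge01_def)
  assume i: "0 < i" "i \<le> p"
  have "sum (simplex_edge01 t) {..i} = sum (simplex_edge01 t) {0,1}"
    using i by (intro sum.mono_neutral_right) (auto simp: simplex_edge01_def)
  then have "sum (simplex_edge01 t) {..i} = 1"
    by (simp add: simplex_edge01_def)
  moreover have "simplical_degeneracy i (simplex_edge01 t) = simplex_edge01 t"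
    using i by (auto simp: simplical_degeneracy_def simplex_edge01_def fun_eq_iff)
  moreover have "\<sigma> (simplex_edge01 t) \<in> topspace X"
    using i by (intro singular_simplex_in_topspace[OF \<sigma>] simplex_edge01[OF t]) auto
  ultimately show "homotopy_prism h p i \<sigma> (simplex_edge01 t) = \<sigma> (simplex_edge01 t)"
    using e h0 by (simp add: homotopy_prism_def)
qed

lemma face_coeff_homotopy_prism:
  assumes \<sigma>: "singular_simplex p X \<sigma>" and i: "i \<le> p"
    and r: "r \<in> carrier (fibre R (\<sigma> simplex_vertex0))"
  shows "face_coeff R k (homotopy_prism h p i \<sigma>) r =
     (if 0 < k then r else if i = 0 then transport R (\<lambda>t. h (t, \<sigma> simplex_vertex0)) r
      else face_coeff R 0 \<sigma> r)"
proof -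
  note path = pathin_simplex_edge01[OF singular_simplex_homotopy_prism[OF \<sigma> i], simplified]
  have r': "r \<in> carrier (fibre R (homotopy_prism h p i \<sigma> (simplex_edge01 0)))"
    using r \<sigma> by (simp add: simplex_edge01_0 homotopy_prism_vertex0)
  have first: "transport R (\<lambda>t. homotopy_prism h p i \<sigma> (simplex_edge01 t)) r =
      transport R (\<lambda>t. h (t, \<sigma> simplex_vertex0)) r" if "i = 0"
    by (rule transport_cong[OF R path _ r']) (use that homotopy_prism_edge01(1)[OF \<sigma>] in simp)
  have later: "transport R (\<lambda>t. homotopy_prism h p i \<sigma> (simplex_edge01 t)) r =
      transport R (\<lambda>t. \<sigma> (simplex_edge01 t)) r" if "0 < i"
    by (rule transport_cong[OF R path _ r']) (use that i homotopy_prism_edge01(2)[OF \<sigma>] in simp)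
  show ?thesis
    using first later by (simp add: face_coeff_def)
qed

lemma singular_face_homotopy_prism:
  assumes \<sigma>: "singular_simplex p X \<sigma>"
  shows "singular_face (Suc p) 0 (homotopy_prism h p 0 \<sigma>) = simplex_map p f \<sigma>"
    and "singular_face (Suc p) (Suc p) (homotopy_prism h p p \<sigma>) = \<sigma>"
    and "\<lbrakk>0 < i; i \<le> p\<rbrakk> \<Longrightarrow> singular_face (Suc p) i (homotopy_prism h p i \<sigma>) =
           singular_face (Suc p) i (homotopy_prism h p (i - 1) \<sigma>)"
    and "\<lbrakk>k < i; i \<le> p\<rbrakk> \<Longrightarrow> singular_face (Suc p) k (homotopy_prism h p i \<sigma>) =
           homotopy_prism h (p - 1) (i - 1) (singular_face p k \<sigma>)"
    and "\<lbrakk>Suc i < k; k \<le> Suc p\<rbrakk> \<Longrightarrow> singular_face (Suc p) k (homotopy_prism h p i \<sigma>) =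
           homotopy_prism h (p - 1) i (singular_face p (k - 1) \<sigma>)"
proof -
  have face: "singular_face (Suc p) k (homotopy_prism h p i \<sigma>) x =
      h (1 - sum (simplical_face k x) {..i}, \<sigma> (simplical_degeneracy i (simplical_face k x)))"
    if "x \<in> standard_simplex p" "k \<le> Suc p" for x k i
    using simplical_face_in_standard_simplex[of "Suc p" k x] that
    by (simp add: singular_face_apply homotopy_prism_def)
  have out: "singular_face (Suc p) k \<tau> x = undefined" if "x \<notin> standard_simplex p" for k x and \<tau> :: "(nat \<Rightarrow> real) \<Rightarrow> 'a"
    using that by (simp add: singular_face_def)
  have \<sigma>x: "\<sigma> x \<in> topspace X" if "x \<in> standard_simplex p" for x
    using singular_simplex_in_topspace[OF \<sigma> that] .
  have prism: "homotopy_prism h (p - 1) i (singular_face p k \<sigma>) x =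
      h (1 - sum x {..i}, \<sigma> (simplical_face k (simplical_degeneracy i x)))"
    if x: "x \<in> standard_simplex p" and i: "i < p" for x k i
  proof -
    obtain m where m: "p = Suc m" using i by (cases p) auto
    have "simplical_degeneracy i x \<in> standard_simplex m"
      using x i by (intro simplical_degeneracy_in_standard_simplex) (auto simp: m)
    with x show ?thesis by (simp add: homotopy_prism_def m singular_face_apply)
  qed
  have prism_out: "homotopy_prism h (p - 1) i \<tau> x = undefined"
    if "x \<notin> standard_simplex p" "i < p" for x i and \<tau> :: "(nat \<Rightarrow> real) \<Rightarrow> 'a"
    using that by (simp add: homotopy_prism_def)
  show "singular_face (Suc p) 0 (homotopy_prism h p 0 \<sigma>) = simplex_map p f \<sigma>"
  proof
    fix x show "singular_face (Suc p) 0 (homotopy_prism h p 0 \<sigma>) x = simplex_map p f \<sigma> x"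
    proof (cases "x \<in> standard_simplex p")
      case True
      have "sum (simplical_face 0 x) {..0} = 0" by (simp add: simplical_face_def)
      with True show ?thesis
        by (simp only: face[OF True] le0 simplical_degeneracy_face(2))
          (simp add: simplex_map_def h1 \<sigma>x)
    qed (simp add: out simplex_map_def)
  qed
  show "singular_face (Suc p) (Suc p) (homotopy_prism h p p \<sigma>) = \<sigma>"
  proof
    fix x show "singular_face (Suc p) (Suc p) (homotopy_prism h p p \<sigma>) x = \<sigma> x"
    proof (cases "x \<in> standard_simplex p")
      case True
      then have "sum x {..p} = 1" by (simp add: standard_simplex_def)
      with True show ?thesis
        by (simp only: face[OF True] order_refl sum_simplical_face(1)[OF lessI] simplical_degeneracy_face(3))
          (simp add: h0 \<sigma>x)
    next
      case False
      then show ?thesis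
        using \<sigma> by (simp add: out singular_simplex_def extensional_def)
    qed
  qed
  show "singular_face (Suc p) i (homotopy_prism h p i \<sigma>) =
           singular_face (Suc p) i (homotopy_prism h p (i - 1) \<sigma>)" if i: "0 < i" "i \<le> p" for i
  proof
    obtain j where j: "i = Suc j" using i by (cases i) auto
    fix x show "singular_face (Suc p) i (homotopy_prism h p i \<sigma>) x =
           singular_face (Suc p) i (homotopy_prism h p (i - 1) \<sigma>) x"
    proof (cases "x \<in> standard_simplex p")
      case True
      then show ?thesis
        using i(2)
        by (simp only: face[OF True le_SucI] j sum_simplical_face(2)[OF order_refl]
            sum_simplical_face(1)[OF lessI] simplical_degeneracy_face(2,3) diff_Suc_1 lessThan_Suc_atMost)
    qed (simp add: out)
  qed
  show "singular_face (Suc p) k (homotopy_prism h p i \<sigma>) =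
           homotopy_prism h (p - 1) (i - 1) (singular_face p k \<sigma>)" if ki: "k < i" "i \<le> p" for k i
  proof
    obtain j where j: "i = Suc j" using ki by (cases i) auto
    fix x show "singular_face (Suc p) k (homotopy_prism h p i \<sigma>) x =
           homotopy_prism h (p - 1) (i - 1) (singular_face p k \<sigma>) x"
    proof (cases "x \<in> standard_simplex p")
      case False
      have "i - 1 < p" using ki by auto
      then show ?thesis by (simp only: out[OF False] prism_out[OF False])
    next
      case True
      have "k \<le> Suc p" "i - 1 < p" using ki by auto
      then show ?thesis
        by (simp only: face[OF True] prism[OF True] sum_simplical_face(2)[OF less_imp_le[OF ki(1)]]
            simplical_degeneracy_face(1)[OF ki(1)]) (simp add: j lessThan_Suc_atMost)
    qed
  qed
  show "singular_face (Suc p) k (homotopy_prism h p i \<sigma>) =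
           homotopy_prism h (p - 1) i (singular_face p (k - 1) \<sigma>)" if ki: "Suc i < k" "k \<le> Suc p" for k i
  proof
    fix x show "singular_face (Suc p) k (homotopy_prism h p i \<sigma>) x =
           homotopy_prism h (p - 1) i (singular_face p (k - 1) \<sigma>) x"
    proof (cases "x \<in> standard_simplex p")
      case False
      have "i < p" using ki by auto
      then show ?thesis by (simp only: out[OF False] prism_out[OF False])
    next
      case True
      have "i < p" using ki by auto
      then show ?thesis
        using ki(2)
        by (simp only: face[OF True] prism[OF True] sum_simplical_face(1)[OF Suc_lessD[OF ki(1)]]
            simplical_degeneracy_face(4)[OF ki(1)])
    qed
  qed
qed

lemma frag_op_prism_0:
  assumes "Poly_Mapping.keys u \<subseteq> local_generators 0 X R"
  shows "frag_op 1 (face_coeff R) (singular_face 1) (frag_op 0 (\<lambda>i \<sigma> r. r) (homotopy_prism h 0) u) =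
    frag_op 0 (\<lambda>k \<sigma>. transport R (\<lambda>t. h (t, \<sigma> simplex_vertex0))) (\<lambda>k. simplex_map 0 f) u - u"
  using assms
proof (induction rule: free_Abelian_group_induct[consumes 1])
  case (3 g)
  obtain r \<sigma> where g: "g = (r, \<sigma>)" by (cases g)
  have \<sigma>: "singular_simplex 0 X \<sigma>" and r: "r \<in> carrier (fibre R (\<sigma> simplex_vertex0))"
    using 3 g by (auto simp: local_generators_def)
  show ?case
    using face_coeff_homotopy_prism[OF \<sigma> _ r] singular_face_homotopy_prism(1,2)[OF \<sigma>]
    by (simp add: g frag_op_def)
qed (simp_all add: frag_op_def frag_extend_diff)

lemma frag_op_prism_Suc:
  assumes "Poly_Mapping.keys u \<subseteq> local_generators (Suc m) X R"
  shows "frag_op (Suc (Suc m)) (face_coeff R) (singular_face (Suc (Suc m)))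
           (frag_op (Suc m) (\<lambda>i \<sigma> r. r) (homotopy_prism h (Suc m)) u) =
    frag_op 0 (\<lambda>k \<sigma>. transport R (\<lambda>t. h (t, \<sigma> simplex_vertex0))) (\<lambda>k. simplex_map (Suc m) f) u - u
    - frag_op m (\<lambda>i \<sigma> r. r) (homotopy_prism h m)
        (frag_op (Suc m) (face_coeff R) (singular_face (Suc m)) u)"
  using assms
proof (induction rule: free_Abelian_group_induct[consumes 1])
  case (3 g)
  obtain r \<sigma> where g: "g = (r, \<sigma>)" by (cases g)
  have \<sigma>: "singular_simplex (Suc m) X \<sigma>" and r: "r \<in> carrier (fibre R (\<sigma> simplex_vertex0))"
    using 3 g by (auto simp: local_generators_def)
  note coeff = face_coeff_homotopy_prism[OF \<sigma> _ r]
  note face = singular_face_homotopy_prism[OF \<sigma>]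
  define a where "a i k = frag_of (face_coeff R k (homotopy_prism h (Suc m) i \<sigma>) r,
      singular_face (Suc (Suc m)) k (homotopy_prism h (Suc m) i \<sigma>))" for i k
  define b where "b i k = frag_of (face_coeff R k \<sigma> r,
      homotopy_prism h m i (singular_face (Suc m) k \<sigma>))" for i k
  have "frag_op (Suc (Suc m)) (face_coeff R) (singular_face (Suc (Suc m)))
           (frag_op (Suc m) (\<lambda>i \<sigma> r. r) (homotopy_prism h (Suc m)) (frag_of g)) =
      (\<Sum>i\<le>Suc m. \<Sum>k\<le>Suc (Suc m). frag_cmul ((- 1) ^ (i + k)) (a i k))"
    by (simp add: g a_def frag_op_def frag_extend_sum frag_extend_cmul frag_cmul_sum o_def power_add
          del: sum.atMost_Suc)
  also have "\<dots> = a 0 0 - a (Suc m) (Suc (Suc m))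
             - (\<Sum>k\<le>Suc m. \<Sum>i\<le>m. frag_cmul ((- 1) ^ (i + k)) (b i k))"
  proof (rule alternating_prism_sum)
    show "a i k = b (i - 1) k" if "k < i" "i \<le> Suc m" for i k
      using that by (auto simp: a_def b_def coeff face(4)) (simp add: face_coeff_def)
    show "a i k = b i (k - 1)" if "Suc i < k" "k \<le> Suc (Suc m)" for i k
      using that by (auto simp: a_def b_def coeff face(5)) (simp add: face_coeff_def)
    show "a i i = a (i - 1) i" if "0 < i" "i \<le> Suc m" for i
      using that by (simp add: a_def coeff face(3))
  qed
  also have "a 0 0 = frag_op 0 (\<lambda>k \<sigma>. transport R (\<lambda>t. h (t, \<sigma> simplex_vertex0)))
      (\<lambda>k. simplex_map (Suc m) f) (frag_of g)"
    by (simp add: a_def g coeff face(1) frag_op_def)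
  also have "a (Suc m) (Suc (Suc m)) = frag_of g"
    by (simp add: a_def g coeff face(2))
  also have "(\<Sum>k\<le>Suc m. \<Sum>i\<le>m. frag_cmul ((- 1) ^ (i + k)) (b i k)) =
      frag_op m (\<lambda>i \<sigma> r. r) (homotopy_prism h m)
        (frag_op (Suc m) (face_coeff R) (singular_face (Suc m)) (frag_of g))"
    by (simp add: g b_def frag_op_def frag_extend_sum frag_extend_cmul frag_cmul_sum o_def power_add
          mult.commute del: sum.atMost_Suc)
  finally show ?case .
qed (simp_all add: frag_op_def frag_extend_diff)

lemma local_chain_map_homologous_id:
  assumes f: "coeff_morphism X R X R f (\<lambda>x. transport R (\<lambda>t. h (t, x)))"
    and c: "c \<in> local_cycles q X R"
  obtains b where "b \<in> local_boundaries q X R"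
    "local_chain_map q X R X R f (\<lambda>x. transport R (\<lambda>t. h (t, x))) c = b \<otimes>\<^bsub>local_chain_group q X R\<^esub> c"
proof -
  let ?F = "local_chain_map q X R X R f (\<lambda>x. transport R (\<lambda>t. h (t, x)))"
  let ?P = "\<lambda>q. chain_op q (\<lambda>i \<sigma> r. r) (homotopy_prism h q) q X R (Suc q) X R"
  interpret C: comm_group "local_chain_group q X R"
    by (rule comm_group_local_chain_group[OF R])
  have cC: "c \<in> carrier (local_chain_group q X R)"
    and dc: "local_boundary q X R c = \<one>\<^bsub>local_chain_group (q - 1) X R\<^esub>"
    using c by (auto simp: local_cycles_def)
  have P: "?P q \<in> hom (local_chain_group q X R) (local_chain_group (Suc q) X R)" for q
    by (rule chain_op_hom[OF R R chain_op_data_prism])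
  obtain u where u: "Poly_Mapping.keys u \<subseteq> local_generators q X R" "realize q X R u = c"
    using realize_surj[OF R cC] .
  note kP = keys_frag_op[OF R R chain_op_data_prism u(1)]
  note kF = keys_frag_op[OF R R chain_op_data_chain_map[OF f] u(1)]
  have Fc: "realize q X R (frag_op 0 (\<lambda>k \<sigma>. transport R (\<lambda>t. h (t, \<sigma> simplex_vertex0)))
      (\<lambda>k. simplex_map q f) u) = ?F c"
    using local_chain_map_realize[OF f u(1)] u(2) by simp
  have FC: "?F c \<in> carrier (local_chain_group q X R)"
    using hom_in_carrier[OF local_chain_map_hom[OF f] cC] .
  have dP: "local_boundary (Suc q) X R (?P q c) = realize q X R
      (frag_op (Suc q) (face_coeff R) (singular_face (Suc q)) (frag_op q (\<lambda>i \<sigma> r. r) (homotopy_prism h q) u))"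
    using chain_op_realize[OF R R chain_op_data_prism u(1)]
      chain_op_realize[OF R R chain_op_data_boundary[OF R] kP] u(2)
    by (simp add: local_boundary_Suc)
  have "local_boundary (Suc q) X R (?P q c) =
      ?F c \<otimes>\<^bsub>local_chain_group q X R\<^esub> inv\<^bsub>local_chain_group q X R\<^esub> c"
  proof (cases q)
    case 0
    have "local_boundary (Suc q) X R (?P q c) = realize q X R
        (frag_op 0 (\<lambda>k \<sigma>. transport R (\<lambda>t. h (t, \<sigma> simplex_vertex0))) (\<lambda>k. simplex_map q f) u - u)"
      unfolding dP using frag_op_prism_0[OF u(1)[unfolded 0]] by (simp only: 0 One_nat_def)
    also have "\<dots> = ?F c \<otimes>\<^bsub>local_chain_group q X R\<^esub> inv\<^bsub>local_chain_group q X R\<^esub> c"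
      unfolding realize_diff[OF R kF u(1)] Fc u(2) ..
    finally show ?thesis .
  next
    case (Suc m)
    note u' = u[unfolded Suc]
    note kD = keys_frag_op[OF R R chain_op_data_boundary[OF R] u'(1)]
    have kPD: "Poly_Mapping.keys (frag_op m (\<lambda>i \<sigma> r. r) (homotopy_prism h m)
        (frag_op (Suc m) (face_coeff R) (singular_face (Suc m)) u)) \<subseteq> local_generators q X R"
      using keys_frag_op[OF R R chain_op_data_prism kD] by (simp only: Suc)
    have kFu: "Poly_Mapping.keys (frag_op 0 (\<lambda>k \<sigma>. transport R (\<lambda>t. h (t, \<sigma> simplex_vertex0)))
      (\<lambda>k. simplex_map q f) u - u) \<subseteq> local_generators q X R"
      by (intro order_trans[OF keys_diff] Un_least kF u(1))
    have "realize (Suc m) X R (frag_op m (\<lambda>i \<sigma> r. r) (homotopy_prism h m)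
        (frag_op (Suc m) (face_coeff R) (singular_face (Suc m)) u)) = ?P m (local_boundary (Suc m) X R c)"
      using chain_op_realize[OF R R chain_op_data_prism kD]
        chain_op_realize[OF R R chain_op_data_boundary[OF R] u'(1)] u'(2)
      by (simp add: local_boundary_Suc)
    also have "\<dots> = ?P m \<one>\<^bsub>local_chain_group m X R\<^esub>"
      using dc Suc by simp
    also have "\<dots> = \<one>\<^bsub>local_chain_group q X R\<^esub>"
      using hom_one[OF P[of m]] comm_group_local_chain_group[OF R] Suc
      by (simp add: comm_group_def del: one_sum_group)
    finally have one: "realize q X R (frag_op m (\<lambda>i \<sigma> r. r) (homotopy_prism h m)
        (frag_op (Suc m) (face_coeff R) (singular_face (Suc m)) u)) = \<one>\<^bsub>local_chain_group q X R\<^esub>"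
      by (simp add: Suc)
    have "local_boundary (Suc q) X R (?P q c) = realize q X R
        (frag_op 0 (\<lambda>k \<sigma>. transport R (\<lambda>t. h (t, \<sigma> simplex_vertex0))) (\<lambda>k. simplex_map q f) u - u
         - frag_op m (\<lambda>i \<sigma> r. r) (homotopy_prism h m)
             (frag_op (Suc m) (face_coeff R) (singular_face (Suc m)) u))"
      unfolding dP using frag_op_prism_Suc[OF u'(1)] by (simp only: Suc)
    also have "\<dots> = (?F c \<otimes>\<^bsub>local_chain_group q X R\<^esub> inv\<^bsub>local_chain_group q X R\<^esub> c)
        \<otimes>\<^bsub>local_chain_group q X R\<^esub> inv\<^bsub>local_chain_group q X R\<^esub> \<one>\<^bsub>local_chain_group q X R\<^esub>"
      unfolding realize_diff[OF R kFu kPD] realize_diff[OF R kF u(1)] Fc u(2) one ..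
    also have "\<dots> = ?F c \<otimes>\<^bsub>local_chain_group q X R\<^esub> inv\<^bsub>local_chain_group q X R\<^esub> c"
      using FC cC by (simp del: mult_sum_group one_sum_group)
    finally show ?thesis .
  qed
  moreover have "local_boundary (Suc q) X R (?P q c) \<in> local_boundaries q X R"
    using hom_in_carrier[OF P cC] by (auto simp: local_boundaries_def)
  ultimately have "?F c \<otimes>\<^bsub>local_chain_group q X R\<^esub> inv\<^bsub>local_chain_group q X R\<^esub> c \<in> local_boundaries q X R"
    by (simp only:)
  moreover have "?F c = (?F c \<otimes>\<^bsub>local_chain_group q X R\<^esub> inv\<^bsub>local_chain_group q X R\<^esub> c) \<otimes>\<^bsub>local_chain_group q X R\<^esub> c"
    using FC cC by (simp add: C.m_assoc del: mult_sum_group one_sum_group)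
  ultimately show ?thesis
    by (rule that)
qed

end

section \<open>Homology classes as cosets\<close>

lemma local_cycles_eq_kernel:
  "local_cycles q X R = kernel (local_chain_group q X R) (local_chain_group (q - 1) X R) (local_boundary q X R)"
  by (simp add: local_cycles_def kernel_def)

lemma group_hom_local_boundary:
  assumes "local_system X R"
  shows "group_hom (local_chain_group q X R) (local_chain_group (q - 1) X R) (local_boundary q X R)"
  using comm_group_local_chain_group[OF assms] local_boundary_hom[OF assms]
  by (auto simp: group_hom_def group_hom_axioms_def comm_group_def)

lemma subgroup_local_cycles:
  assumes "local_system X R"
  shows "subgroup (local_cycles q X R) (local_chain_group q X R)"
  unfolding local_cycles_eq_kernel
  by (rule group_hom.subgroup_kernel[OF group_hom_local_boundary[OF assms]])

lemma subgroup_local_boundaries: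
  assumes "local_system X R"
  shows "subgroup (local_boundaries q X R) (local_chain_group q X R)"
  using group_hom.img_is_subgroup[OF group_hom_local_boundary[OF assms, of "Suc q"]]
  by (simp add: local_boundaries_def)

lemma carrier_local_homology_group:
  assumes R: "local_system X R"
  shows "carrier (local_homology_group q X R) =
     (\<lambda>c. local_boundaries q X R #>\<^bsub>local_chain_group q X R\<^esub> c) ` local_cycles q X R"
proof -
  have "carrier (subgroup_generated (local_chain_group q X R) (local_cycles q X R)) = local_cycles q X R"
    by (rule subgroup.carrier_subgroup_generated_subgroup[OF subgroup_local_cycles[OF R]])
  then show ?thesis
    by (auto simp: local_homology_group_def FactGroup_def RCOSETS_def r_coset_def simp del: mult_sum_group)
qed

context
  fixes X :: "'a topology" and R :: "('a, 'r) coeff_system"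
    and Y :: "'b topology" and S :: "('b, 's) coeff_system" and f \<phi>
  assumes f\<phi>: "coeff_morphism X R Y S f \<phi>"
begin

lemma local_chain_map_cycles:
  assumes c: "c \<in> local_cycles q X R"
  shows "local_chain_map q X R Y S f \<phi> c \<in> local_cycles q Y S"
proof -
  have "group (local_chain_group (q - 1) X R)" "group (local_chain_group (q - 1) Y S)"
    using comm_group_local_chain_group coeff_morphismD(1,2)[OF f\<phi>] by (auto simp: comm_group_def)
  then show ?thesis
    using c local_boundary_chain_map[OF f\<phi>, of c q] hom_in_carrier[OF local_chain_map_hom[OF f\<phi>]]
      hom_one[OF local_chain_map_hom[OF f\<phi>], of "q - 1"]
    by (simp add: local_cycles_def del: one_sum_group)
qed

lemma local_chain_map_boundaries:
  assumes "b \<in> local_boundaries q X R"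
  shows "local_chain_map q X R Y S f \<phi> b \<in> local_boundaries q Y S"
proof -
  obtain d where d: "d \<in> carrier (local_chain_group (Suc q) X R)" "b = local_boundary (Suc q) X R d"
    using assms by (auto simp: local_boundaries_def)
  then have "local_chain_map q X R Y S f \<phi> b =
      local_boundary (Suc q) Y S (local_chain_map (Suc q) X R Y S f \<phi> d)"
    using local_boundary_chain_map[OF f\<phi> d(1)] by simp
  then show ?thesis
    using hom_in_carrier[OF local_chain_map_hom[OF f\<phi>] d(1)] by (auto simp: local_boundaries_def)
qed

lemma local_hom_induced_coset:
  assumes c: "c \<in> carrier (local_chain_group q X R)"
  shows "local_hom_induced q X R Y S f \<phi> (local_boundaries q X R #>\<^bsub>local_chain_group q X R\<^esub> c) =
     local_boundaries q Y S #>\<^bsub>local_chain_group q Y S\<^esub> local_chain_map q X R Y S f \<phi> c"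
proof -
  let ?F = "local_chain_map q X R Y S f \<phi>"
  let ?C = "local_chain_group q X R" and ?D = "local_chain_group q Y S"
  let ?B = "local_boundaries q X R" and ?E = "local_boundaries q Y S"
  interpret C: comm_group ?C
    by (rule comm_group_local_chain_group[OF coeff_morphismD(1)[OF f\<phi>]])
  interpret D: comm_group ?D
    by (rule comm_group_local_chain_group[OF coeff_morphismD(2)[OF f\<phi>]])
  interpret B: subgroup ?B ?C
    by (rule subgroup_local_boundaries[OF coeff_morphismD(1)[OF f\<phi>]])
  interpret E: subgroup ?E ?D
    by (rule subgroup_local_boundaries[OF coeff_morphismD(2)[OF f\<phi>]])
  have Fc: "?F c \<in> carrier ?D"
    using hom_in_carrier[OF local_chain_map_hom[OF f\<phi>] c] .
  have "e \<otimes>\<^bsub>?D\<^esub> ?F (b \<otimes>\<^bsub>?C\<^esub> c) = (e \<otimes>\<^bsub>?D\<^esub> ?F b) \<otimes>\<^bsub>?D\<^esub> ?F c"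
    and "e \<otimes>\<^bsub>?D\<^esub> ?F b \<in> ?E" if "e \<in> ?E" "b \<in> ?B" for e b
    using that c Fc local_chain_map_boundaries hom_mult[OF local_chain_map_hom[OF f\<phi>]]
    by (simp_all add: D.m_assoc del: mult_sum_group)
  then have "?E <#>\<^bsub>?D\<^esub> (?F ` (?B #>\<^bsub>?C\<^esub> c)) \<subseteq> ?E #>\<^bsub>?D\<^esub> ?F c"
    unfolding set_mult_def r_coset_def by fastforce
  moreover have "?E #>\<^bsub>?D\<^esub> ?F c \<subseteq> ?E <#>\<^bsub>?D\<^esub> (?F ` (?B #>\<^bsub>?C\<^esub> c))"
  proof -
    have "?F c = ?F (\<one>\<^bsub>?C\<^esub> \<otimes>\<^bsub>?C\<^esub> c)"
      by (simp only: C.l_one c)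
    then have "?F c \<in> ?F ` (?B #>\<^bsub>?C\<^esub> c)"
      unfolding r_coset_def using B.one_closed by blast
    then show ?thesis
      unfolding set_mult_def r_coset_def by blast
  qed
  ultimately show ?thesis
    unfolding local_hom_induced_def by blast
qed

end

section \<open>Invariance of category weight\<close>

lemma cwgt_ge_coset_iff:
  fixes X :: "'a topology"
  assumes R: "local_system X R"
  shows "cwgt_ge q X R z k \<longleftrightarrow>
    (\<forall>A. closedin X A \<longrightarrow> cat_le X A k \<longrightarrow>
      (\<exists>c \<in> local_cycles q (subtopology X (topspace X - A)) R.
         z = local_boundaries q X R #>\<^bsub>local_chain_group q X R\<^esub>
           local_chain_map q (subtopology X (topspace X - A)) R X R id (\<lambda>x. id) c))"
proof -
  have "local_hom_induced q (subtopology X U) R X R id (\<lambda>x. id)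
          ` carrier (local_homology_group q (subtopology X U) R) =
        (\<lambda>c. local_boundaries q X R #>\<^bsub>local_chain_group q X R\<^esub>
           local_chain_map q (subtopology X U) R X R id (\<lambda>x. id) c) ` local_cycles q (subtopology X U) R" for U
  proof -
    have "local_hom_induced q (subtopology X U) R X R id (\<lambda>x. id)
        (local_boundaries q (subtopology X U) R #>\<^bsub>local_chain_group q (subtopology X U) R\<^esub> c) =
        local_boundaries q X R #>\<^bsub>local_chain_group q X R\<^esub>
           local_chain_map q (subtopology X U) R X R id (\<lambda>x. id) c"
      if "c \<in> local_cycles q (subtopology X U) R" for c
      using that
      by (intro local_hom_induced_coset[OF coeff_morphism_into_subtopology[OF R]])
         (simp add: local_cycles_def)
    then show ?thesis
      by (simp add: carrier_local_homology_group[OF local_system_subtopology[OF R]] image_image)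
  qed
  then show ?thesis
    unfolding cwgt_ge_def by (auto simp: image_iff)
qed

lemma cwgt_ge_induced:
  assumes f: "coeff_morphism X R Y S f \<phi>" and c: "c \<in> local_cycles q X R"
    and cat: "\<And>A. closedin Y A \<Longrightarrow> cat_le Y A k \<Longrightarrow> cat_le X {x \<in> topspace X. f x \<in> A} k"
    and ge: "cwgt_ge q X R (local_boundaries q X R #>\<^bsub>local_chain_group q X R\<^esub> c) k"
  shows "cwgt_ge q Y S (local_boundaries q Y S #>\<^bsub>local_chain_group q Y S\<^esub>
           local_chain_map q X R Y S f \<phi> c) k"
  unfolding cwgt_ge_coset_iff[OF coeff_morphismD(2)[OF f]]
proof (intro allI impI)
  note R = coeff_morphismD(1)[OF f] and S = coeff_morphismD(2)[OF f]
  fix A assume A: "closedin Y A" "cat_le Y A k"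
  let ?A = "{x \<in> topspace X. f x \<in> A}"
  let ?U = "subtopology X (topspace X - ?A)" and ?V = "subtopology Y (topspace Y - A)"
  have "closedin X ?A"
    using A(1) coeff_morphismD(3)[OF f] by (simp add: closedin_continuous_map_preimage)
  with cat[OF A] ge obtain d where d: "d \<in> local_cycles q ?U R"
      "local_boundaries q X R #>\<^bsub>local_chain_group q X R\<^esub> c =
       local_boundaries q X R #>\<^bsub>local_chain_group q X R\<^esub> local_chain_map q ?U R X R id (\<lambda>x. id) d"
    unfolding cwgt_ge_coset_iff[OF R] by blast
  have "f ` (topspace X \<inter> (topspace X - ?A)) \<subseteq> topspace Y - A"
    using coeff_morphismD(3)[OF f] by (auto simp: continuous_map_def)
  then have fU: "coeff_morphism ?U R ?V S f \<phi>"
    by (rule coeff_morphism_subtopology[OF f])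
  note i = coeff_morphism_into_subtopology[OF R, of "topspace X - ?A"]
    and j = coeff_morphism_into_subtopology[OF S, of "topspace Y - A"]
  have carr: "c \<in> carrier (local_chain_group q X R)" "d \<in> carrier (local_chain_group q ?U R)"
    using c d by (auto simp: local_cycles_def)
  have fi: "f \<circ> id = f" "(\<lambda>x. \<phi> (id x) \<circ> id) = \<phi>"
    by (simp_all add: fun_eq_iff)
  have "local_chain_map q X R Y S f \<phi> (local_chain_map q ?U R X R id (\<lambda>x. id) d) =
      local_chain_map q ?U R Y S f \<phi> d"
    using local_chain_map_compose[OF i f coeff_morphism_compose[OF i f] carr(2)]
    unfolding fi .
  also have "\<dots> = local_chain_map q ?V S Y S id (\<lambda>x. id) (local_chain_map q ?U R ?V S f \<phi> d)"
    using local_chain_map_compose[OF fU j coeff_morphism_compose[OF fU j] carr(2)]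
    unfolding id_comp by (rule sym)
  finally have eq: "local_chain_map q X R Y S f \<phi> (local_chain_map q ?U R X R id (\<lambda>x. id) d) =
      local_chain_map q ?V S Y S id (\<lambda>x. id) (local_chain_map q ?U R ?V S f \<phi> d)" .
  have "local_boundaries q Y S #>\<^bsub>local_chain_group q Y S\<^esub> local_chain_map q X R Y S f \<phi> c =
      local_hom_induced q X R Y S f \<phi> (local_boundaries q X R #>\<^bsub>local_chain_group q X R\<^esub> c)"
    using local_hom_induced_coset[OF f carr(1)] by simp
  also have "\<dots> = local_boundaries q Y S #>\<^bsub>local_chain_group q Y S\<^esub>
      local_chain_map q ?V S Y S id (\<lambda>x. id) (local_chain_map q ?U R ?V S f \<phi> d)"
    unfolding d(2) eq[symmetric]
    by (rule local_hom_induced_coset[OF f hom_in_carrier[OF local_chain_map_hom[OF i] carr(2)]])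
  finally show "\<exists>c' \<in> local_cycles q ?V S.
      local_boundaries q Y S #>\<^bsub>local_chain_group q Y S\<^esub> local_chain_map q X R Y S f \<phi> c =
      local_boundaries q Y S #>\<^bsub>local_chain_group q Y S\<^esub> local_chain_map q ?V S Y S id (\<lambda>x. id) c'"
    using local_chain_map_cycles[OF fU d(1)] by blast
qed

lemma cat_le_preimage:
  assumes f: "continuous_map X Y f" and g: "continuous_map Y X g"
    and gf: "homotopic_with (\<lambda>k. True) X X (g \<circ> f) id"
    and cat: "cat_le Y A k"
  shows "cat_le X {x \<in> topspace X. f x \<in> A} k"
proof -
  obtain U where U: "A \<subseteq> (\<Union>i<k. U i)" "\<And>i. i < k \<Longrightarrow> openin Y (U i)"
    and null: "\<And>i. i < k \<Longrightarrow> \<exists>a. homotopic_with (\<lambda>h. True) (subtopology Y (U i)) Y id (\<lambda>y. a)"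
    using cat unfolding cat_le_def by blast
  define V where "V i = {x \<in> topspace X. f x \<in> U i}" for i
  have "openin X (V i)" if "i < k" for i
    unfolding V_def using openin_continuous_map_preimage[OF f U(2)[OF that]] .
  moreover have "\<exists>b. homotopic_with (\<lambda>h. True) (subtopology X (V i)) X id (\<lambda>x. b)" if "i < k" for i
  proof -
    obtain a where a: "homotopic_with (\<lambda>h. True) (subtopology Y (U i)) Y id (\<lambda>y. a)"
      using null[OF \<open>i < k\<close>] by blast
    have fV: "continuous_map (subtopology X (V i)) (subtopology Y (U i)) f"
      using f by (auto simp: V_def continuous_map_in_subtopology intro: continuous_map_from_subtopology)
    have "homotopic_with (\<lambda>h. True) (subtopology X (V i)) X ((g \<circ> id) \<circ> f) ((g \<circ> (\<lambda>y. a)) \<circ> f)"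
      by (rule homotopic_with_compose_continuous_map_right[OF
            homotopic_with_compose_continuous_map_left[OF a g] fV]) auto
    then have "homotopic_with (\<lambda>h. True) (subtopology X (V i)) X (g \<circ> f) (\<lambda>x. g a)"
      by (simp add: o_def)
    moreover have "homotopic_with (\<lambda>h. True) (subtopology X (V i)) X id (g \<circ> f)"
      using homotopic_with_compose_continuous_map_right[OF gf, of "subtopology X (V i)" id]
      by (simp add: continuous_map_from_subtopology homotopic_with_sym)
    ultimately show ?thesis
      using homotopic_with_trans by blast
  qed
  moreover have "{x \<in> topspace X. f x \<in> A} \<subseteq> (\<Union>i<k. V i)"
    using U(1) by (auto simp: V_def)
  ultimately show ?thesis
    unfolding cat_le_def by blast
qed

lemma path_homotopic_square:
  assumes K: "continuous_map (prod_topology (top_of_set {0..1}) (top_of_set {0..1})) X K"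
  shows "path_homotopic X (path_concat (\<lambda>s. K (0, s)) (\<lambda>t. K (t, 1)))
           (path_concat (\<lambda>t. K (t, 0)) (\<lambda>s. K (1, s)))"
proof -
  let ?S = "{0..1::real} \<times> {0..1::real}"
  let ?a = "linepath (0, 0) (0, 1) +++ linepath (0, 1) (1, 1) :: real \<Rightarrow> real \<times> real"
  let ?b = "linepath (0, 0) (1, 0) +++ linepath (1, 0) (1, 1) :: real \<Rightarrow> real \<times> real"
  have conv: "convex ?S"
    by (intro convex_Times) auto
  have "path_image ?a \<subseteq> ?S" "path_image ?b \<subseteq> ?S"
    by (intro subset_path_image_join; simp add: closed_segment_subset[OF _ _ conv])+
  then have "closed_segment (?a t) (?b t) \<subseteq> ?S" if "t \<in> {0..1}" for t
    using that conv by (intro closed_segment_subset) (auto simp: path_image_def)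
  then have "homotopic_paths ?S ?a ?b"
    by (intro homotopic_paths_linear) auto
  moreover have "continuous_map (top_of_set ?S) X K"
    using K by (simp add: prod_topology_subtopology_eu)
  ultimately have "homotopic_with (\<lambda>r. r 0 = (K \<circ> ?a) 0 \<and> r 1 = (K \<circ> ?a) 1)
      (top_of_set {0..1}) X (K \<circ> ?a) (K \<circ> ?b)"
    unfolding homotopic_paths_def
    by (rule homotopic_with_compose_continuous_map_left) (auto simp: pathstart_def pathfinish_def)
  moreover have "K \<circ> ?a = path_concat (\<lambda>s. K (0, s)) (\<lambda>t. K (t, 1))"
    and "K \<circ> ?b = path_concat (\<lambda>t. K (t, 0)) (\<lambda>s. K (1, s))"
    by (auto simp: joinpaths_def path_concat_def linepath_def fun_eq_iff)
  ultimately show ?thesis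
    unfolding path_homotopic_def by simp
qed

context
  fixes X :: "'a topology" and R :: "('a, 'r) coeff_system" and h :: "real \<times> 'a \<Rightarrow> 'a"
    and f :: "'a \<Rightarrow> 'a"
  assumes R: "local_system X R"
    and h: "continuous_map (prod_topology (top_of_set {0..1}) X) X h"
    and h0: "\<And>x. x \<in> topspace X \<Longrightarrow> h (0, x) = x"
    and h1: "\<And>x. x \<in> topspace X \<Longrightarrow> h (1, x) = f x"
begin

lemma pathin_homotopy_track:
  assumes "x \<in> topspace X"
  shows "pathin X (\<lambda>t. h (t, x))"
proof -
  have "continuous_map (top_of_set {0..1}) (prod_topology (top_of_set {0..1}) X) (\<lambda>t. (t, x))"
    using assms by (intro continuous_map_pairedI) auto
  from continuous_map_compose[OF this h] show ?thesis
    by (simp add: pathin_def o_def)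
qed

lemma transport_homotopy_natural:
  assumes p: "pathin X p" and r: "r \<in> carrier (fibre R (p 0))"
  shows "transport R (\<lambda>t. h (t, p 1)) (transport R p r) =
         transport R (f \<circ> p) (transport R (\<lambda>t. h (t, p 0)) r)"
proof -
  have pt: "p s \<in> topspace X" if "s \<in> {0..1}" for s
    using path_image_subset_topspace[OF p] that by auto
  have "continuous_map (prod_topology (top_of_set {0..1}) (top_of_set {0..1}))
      (prod_topology (top_of_set {0..1}) X) (\<lambda>z. (fst z, (p \<circ> snd) z))"
    using p by (intro continuous_map_pairedI continuous_map_fst continuous_map_compose[OF continuous_map_snd])
      (simp add: pathin_def)
  from continuous_map_compose[OF this h]
  have K: "continuous_map (prod_topology (top_of_set {0..1}) (top_of_set {0..1})) X (\<lambda>(t, s). h (t, p s))"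
    by (simp add: o_def case_prod_unfold)
  have side: "pathin X (\<lambda>s. h (t, p s))" if "t \<in> {0..1}" for t
  proof -
    have "continuous_map (top_of_set {0..1}) (prod_topology (top_of_set {0..1}) X) (\<lambda>s. (t, p s))"
      using that p by (intro continuous_map_pairedI) (auto simp: pathin_def)
    from continuous_map_compose[OF this h] show ?thesis
      by (simp add: pathin_def o_def)
  qed
  note track = pathin_homotopy_track[OF pt]
  have r0: "r \<in> carrier (fibre R (h (0, p 0)))"
    using r pt h0 by simp
  have left: "transport R (\<lambda>s. h (0, p s)) r = transport R p r"
    by (rule transport_cong[OF R side]) (use r0 h0 pt in auto)
  have right: "transport R (\<lambda>s. h (1, p s)) s = transport R (f \<circ> p) s"
    if "s \<in> carrier (fibre R (h (1, p 0)))" for s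
    by (rule transport_cong[OF R side]) (use that h1 pt in auto)
  have "transport R (\<lambda>t. h (t, p 1)) (transport R (\<lambda>s. h (0, p s)) r) =
      transport R (path_concat (\<lambda>s. h (0, p s)) (\<lambda>t. h (t, p 1))) r"
    using r0 by (intro local_systemD(3)[OF R, symmetric] side track) auto
  also have "\<dots> = transport R (path_concat (\<lambda>t. h (t, p 0)) (\<lambda>s. h (1, p s))) r"
    using path_homotopic_square[OF K] r0
    by (intro local_systemD(4)[OF R]) (auto simp: path_concat_def)
  also have "\<dots> = transport R (\<lambda>s. h (1, p s)) (transport R (\<lambda>t. h (t, p 0)) r)"
    using r0 by (intro local_systemD(3)[OF R] side track) auto
  also have "\<dots> = transport R (f \<circ> p) (transport R (\<lambda>t. h (t, p 0)) r)"
    using hom_in_carrier[OF local_systemD(2)[OF R track[of 0]] r0] by (intro right) simp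
  finally show ?thesis
    unfolding left .
qed

end

theorem theorem1:
  fixes X :: "'a topology" and Y :: "'b topology"
    and f :: "'a \<Rightarrow> 'b" and g :: "'b \<Rightarrow> 'a"
    and h :: "real \<times> 'a \<Rightarrow> 'a"
    and R :: "('a, 'r) coeff_system" and R' :: "('b, 'r) coeff_system"
    and q :: nat
    and z :: "(((nat \<Rightarrow> real) \<Rightarrow> 'a) \<Rightarrow> 'r) set"
  assumes "continuous_map X Y f" and "continuous_map Y X g"
    and "homotopic_with (\<lambda>k. True) X X (g \<circ> f) id"
    and "homotopic_with (\<lambda>k. True) Y Y (f \<circ> g) id"
    and "local_system X R"
    and "R' = pullback_system g R"
    and "continuous_map (prod_topology (top_of_set {0..1}) X) X h"
    and "\<forall>x \<in> topspace X. h (0, x) = x"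
    and "\<forall>x \<in> topspace X. h (1, x) = g (f x)"
    and "z \<in> carrier (local_homology_group q X R)"
  shows "cwgt q X R z =
         cwgt q Y R' (local_hom_induced q X R Y R' f (\<lambda>x. transport R (\<lambda>t. h (t, x))) z)"
proof -
  let ?\<phi> = "\<lambda>x. transport R (\<lambda>t. h (t, x))"
  have h0: "\<And>x. x \<in> topspace X \<Longrightarrow> h (0, x) = x"
    and h1: "\<And>x. x \<in> topspace X \<Longrightarrow> h (1, x) = (g \<circ> f) x"
    using assms(8,9) by auto
  note R = assms(5) and homotopy = assms(5,7) h0 h1
  have R': "local_system Y R'"
    unfolding assms(6) by (rule local_system_pullback[OF R assms(2)])
  have \<phi>hom: "?\<phi> x \<in> hom (fibre R x) (fibre R (g (f x)))" if x: "x \<in> topspace X" for x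
    using local_systemD(2)[OF R pathin_homotopy_track[OF homotopy x]] x h0 h1 by simp
  have "?\<phi> (p 1) (transport R p r) = transport R (g \<circ> (f \<circ> p)) (?\<phi> (p 0) r)"
    if "pathin X p" "r \<in> carrier (fibre R (p 0))" for p r
    using transport_homotopy_natural[OF homotopy that] by (simp only: o_assoc)
  then have f: "coeff_morphism X R Y R' f ?\<phi>"
    unfolding coeff_morphism_def
    using R R' assms(1) \<phi>hom by (auto simp: assms(6) pullback_system_def)
  have g: "coeff_morphism Y R' X R g (\<lambda>y. id)"
    unfolding coeff_morphism_def
    using R R' assms(2) by (auto simp: assms(6) pullback_system_def hom_def)
  have gf: "coeff_morphism X R X R (g \<circ> f) ?\<phi>"
    using coeff_morphism_compose[OF f g] by simp
  obtain c where c: "c \<in> local_cycles q X R"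
    and z: "z = local_boundaries q X R #>\<^bsub>local_chain_group q X R\<^esub> c"
    using assms(10) by (auto simp: carrier_local_homology_group[OF R])
  then have cC: "c \<in> carrier (local_chain_group q X R)"
    by (simp add: local_cycles_def)
  let ?fc = "local_chain_map q X R Y R' f ?\<phi> c"
  have fz: "local_hom_induced q X R Y R' f ?\<phi> z =
      local_boundaries q Y R' #>\<^bsub>local_chain_group q Y R'\<^esub> ?fc"
    unfolding z by (rule local_hom_induced_coset[OF f cC])
  interpret C: comm_group "local_chain_group q X R"
    by (rule comm_group_local_chain_group[OF R])
  obtain b where b: "b \<in> local_boundaries q X R"
    and homologous: "local_chain_map q X R X R (g \<circ> f) ?\<phi> c = b \<otimes>\<^bsub>local_chain_group q X R\<^esub> c"
    using local_chain_map_homologous_id[OF homotopy gf c] by blast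
  have "local_chain_map q Y R' X R g (\<lambda>y. id) ?fc = b \<otimes>\<^bsub>local_chain_group q X R\<^esub> c"
    using local_chain_map_compose[OF f g _ cC] gf homologous by simp
  then have gfz: "z = local_boundaries q X R #>\<^bsub>local_chain_group q X R\<^esub>
      local_chain_map q Y R' X R g (\<lambda>y. id) ?fc"
    unfolding z using C.repr_independence[OF _ cC subgroup_local_boundaries[OF R]] b
    by (simp add: r_coset_def del: mult_sum_group) blast
  have "cwgt_ge q X R z k \<longleftrightarrow>
      cwgt_ge q Y R' (local_boundaries q Y R' #>\<^bsub>local_chain_group q Y R'\<^esub> ?fc) k" for k
  proof
    assume "cwgt_ge q X R z k"
    then show "cwgt_ge q Y R' (local_boundaries q Y R' #>\<^bsub>local_chain_group q Y R'\<^esub> ?fc) k"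
      unfolding z using cat_le_preimage[OF assms(1-3)] by (intro cwgt_ge_induced[OF f c])
  next
    assume "cwgt_ge q Y R' (local_boundaries q Y R' #>\<^bsub>local_chain_group q Y R'\<^esub> ?fc) k"
    then show "cwgt_ge q X R z k"
      unfolding gfz
      using cat_le_preimage[OF assms(2,1,4)]
      by (intro cwgt_ge_induced[OF g local_chain_map_cycles[OF f c]])
  qed
  then show ?thesis
    unfolding fz by (simp add: cwgt_def)
qed

end
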